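(* Let $\nu$ be a cardinal (finite or infinite) and let $\rho\ge\mu:=\beth_\omega(\nu)$ be a cardinal. For every $\rho$-uniform family of sets $\mathcal F$ that satisfies condition $C(\rho^+,\nu)$ there exist an enumeration $\mathcal F=\{A_\alpha:\alpha<|\mathcal F|\}$ and a family of sets $\{d_\alpha:\alpha<|\mathcal F|\}$ such that: (i) $d_\alpha\in[A_\alpha]^\rho$ for every $\alpha<|\mathcal F|$, and $d_\beta\cap d_\alpha=\emptyset$ whenever $\beta<\alpha<|\mathcal F|$; (ii) $|\{\beta<\alpha: A_\beta\cap d_\alpha\ne\emptyset\}|<\rho$ for all $\alpha<|\mathcal F|$.
   Context: Work in ZFC. For a cardinal $\nu$: $\beth_0(\nu)=\nu$, $\beth_{n+1}(\nu)=2^{\beth_n(\nu)}$, $\beth_\omega(\nu)=\sup_{n<\omega}\beth_n(\nu)$ (so $\beth_\omega(n)=\aleph_0$ for finite $n$). For a set $X$ and cardinal $\kappa$, $[X]^\kappa$ is the collection of subsets of $X$ of cardinality $\kappa$. A family of sets $\mathcal F$ is $\rho$-uniform if $|A|=\rho$ for all $A\in\mathcal F$. $\mathcal F$ satisfies condition $C(\theta,\nu)$ if $|\bigcap\mathcal A|<\nu$ for every subfamily $\mathcal A\subseteq\mathcal F$ of cardinality $\theta$. *)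

theory Defs
  imports Main
begin

unbundle cardinal_syntax

text \<open>
  A cardinal is a relation satisfying \<^const>\<open>Card_order\<close> (finite cardinals included); two such
  relations, possibly over different types, denote the same cardinal iff they are related by
  \<open>=o\<close>. The ordinals \<open>\<alpha> < |\<F>|\<close> are the elements of \<open>Field |\<F>|\<close>, a well-order whose
  order type is the initial ordinal \<open>|\<F>|\<close>; the ordinals \<open>\<beta> < \<alpha>\<close> form \<open>underS |\<F>| \<alpha>\<close>.
\<close>

text \<open>
  The cardinals \<open>\<beth>\<^sub>n(\<nu>)\<close> live on different types when \<open>n\<close> varies, so the sequence is described
  up to \<open>=o\<close> by representatives on one common type \<open>'b\<close>. If such representatives exist,
  they are unique up to \<open>=o\<close>; they do exist whenever \<open>'b\<close> carries some cardinal
  \<open>\<ge> \<beth>\<^sub>\<omega>(\<nu>)\<close>.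
\<close>

definition is_beth_seq :: "'n rel \<Rightarrow> (nat \<Rightarrow> 'b rel) \<Rightarrow> bool" where
  "is_beth_seq \<nu> b \<longleftrightarrow>
     (\<forall>n. Card_order (b n)) \<and> b 0 =o \<nu> \<and> (\<forall>n. b (Suc n) =o ctwo ^c b n)"

text \<open>
  Comparing only with upper bounds \<open>\<kappa>\<close> on the type of \<open>\<mu>\<close> loses nothing: every cardinal below
  \<open>\<mu>\<close> has a representative there.
\<close>

definition is_beth_omega :: "'n rel \<Rightarrow> 'b rel \<Rightarrow> bool" where
  "is_beth_omega \<nu> \<mu> \<longleftrightarrow> Card_order \<mu> \<and>
     (\<exists>b :: nat \<Rightarrow> 'b rel. is_beth_seq \<nu> b \<and> (\<forall>n. b n \<le>o \<mu>) \<and>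
        (\<forall>\<kappa> :: 'b rel. Card_order \<kappa> \<and> (\<forall>n. b n \<le>o \<kappa>) \<longrightarrow> \<mu> \<le>o \<kappa>))"

definition subsets_of_card :: "'a set \<Rightarrow> 'r rel \<Rightarrow> 'a set set" where
  "subsets_of_card X \<kappa> = {Y. Y \<subseteq> X \<and> |Y| =o \<kappa>}"

definition uniform_family :: "'r rel \<Rightarrow> 'a set set \<Rightarrow> bool" where
  "uniform_family \<rho> \<F> \<longleftrightarrow> (\<forall>A\<in>\<F>. |A| =o \<rho>)"

definition cond_C :: "'t rel \<Rightarrow> 'n rel \<Rightarrow> 'a set set \<Rightarrow> bool" where
  "cond_C \<theta> \<nu> \<F> \<longleftrightarrow> (\<forall>\<A>. \<A> \<subseteq> \<F> \<and> |\<A>| =o \<theta> \<longrightarrow> |\<Inter>\<A>| <o \<nu>)"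

end

theory Submission
  imports Defs Complex_Main
begin

text \<open>
  Call \<open>\<G> \<subseteq> \<F>\<close> closed if every \<open>A \<in> \<F>\<close> that meets \<open>\<Union>\<G>\<close> in at least \<open>\<beth>\<^sub>n(\<nu>)\<close> points
  belongs to \<open>\<G>\<close>. An increasing union of closed families is closed for \<open>n + 1\<close>. If \<open>\<F>\<close> is exhausted
  by a well-ordered chain of closed subfamilies smaller than \<open>\<F>\<close>, then a set entering at some stage
  has fewer than \<open>\<rho>\<close> points in common with all the sets that entered before; so one splits each
  level by induction on \<open>|\<F>|\<close> and removes from the sets \<open>d\<^sub>\<alpha>\<close> the points of the earlier levels.

  Closures must not increase cardinalities \<open>\<lambda> \<ge> \<rho>\<close>. By \<open>C(\<rho>\<^sup>+,\<nu>)\<close> a set of \<open>\<nu>\<close> points is contained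
  in at most \<open>\<rho>\<close> members of \<open>\<F>\<close>, so it suffices that, for large \<open>n\<close>, there are \<open>\<lambda>\<close> many
  functions such that every function from \<open>\<beth>\<^sub>j(\<nu>)\<close> to \<open>\<lambda>\<close> is covered by \<open>\<beth>\<^sub>n(\<nu>)\<close> of them. This form
  of Shelah's revised GCH theorem has an elementary proof by induction on \<open>\<lambda>\<close>, modelled on the
  fact that, given measurable cardinals \<open>\<kappa>\<^sub>0 < \<kappa>\<^sub>1 < \<dots>\<close>, every ordinal is fixed by all but finitely
  many of the corresponding ultrapower embeddings. Complete filters replace the measures.
\<close>

section \<open>Preliminaries on cardinals\<close>

lemma card_of_Pow_mono_ordLeq:
  assumes "|A| \<le>o |B|"
  shows "|Pow A| \<le>o |Pow B|"
proof -
  obtain f where f: "inj_on f A" "f ` A \<subseteq> B"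
    using assms card_of_ordLeq by metis
  have "inj_on ((`) f) (Pow A)"
    using f(1) by (rule inj_on_image_Pow)
  moreover have "(`) f ` Pow A \<subseteq> Pow B"
    using f(2) by blast
  ultimately show ?thesis
    by (intro card_of_ordLeqI) auto
qed

lemma card_of_Times_ordLeq:
  assumes "infinite C" "|A| \<le>o |C|" "|B| \<le>o |C|"
  shows "|A \<times> B| \<le>o |C|"
  using assms card_of_Sigma_ordLeq_infinite[of C A "\<lambda>_. B"] by blast

lemma card_of_Un_ordLeq:
  assumes "infinite C" "|A| \<le>o |C|" "|B| \<le>o |C|"
  shows "|A \<union> B| \<le>o |C|"
proof -
  have "|A \<union> B| \<le>o |C| \<longleftrightarrow> |\<Union>b\<in>(UNIV::bool set). if b then A else B| \<le>o |C|"
    by (simp add: UNIV_bool Un_commute)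
  moreover have "|UNIV::bool set| \<le>o |C|"
    using assms(1) by (meson card_of_ordLeq_infinite finite ordLeq_total card_of_Well_order)
  ultimately show ?thesis
    using card_of_UNION_ordLeq_infinite[OF assms(1), of "UNIV::bool set" "\<lambda>b. if b then A else B"] assms(2,3)
    by simp
qed

lemma card_of_nat_ordLeq: "infinite C \<Longrightarrow> |UNIV::nat set| \<le>o |C|"
  by (simp add: infinite_iff_card_of_nat)

lemma card_of_insert_ordLeq:
  assumes "infinite C" "|A| \<le>o |C|"
  shows "|insert a A| \<le>o |C|"
  using card_of_Un_ordLeq[OF assms(1) card_of_singl_ordLeq[of C a] assms(2)] assms(1) by force

lemma card_of_Func_ordLeq_Pow: "|Func A B| \<le>o |Pow (A \<times> B)|"
proof -
  define gr where "gr f = {(a, b). a \<in> A \<and> b = f a}" for f :: "'a \<Rightarrow> 'b"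
  have "inj_on gr (Func A B)"
  proof (rule inj_onI)
    fix f g assume fg: "f \<in> Func A B" "g \<in> Func A B" "gr f = gr g"
    show "f = g"
    proof
      fix x show "f x = g x"
        using fg by (cases "x \<in> A") (auto simp: gr_def Func_def)
    qed
  qed
  moreover have "gr ` Func A B \<subseteq> Pow (A \<times> B)"
    by (auto simp: gr_def Func_def)
  ultimately show ?thesis
    by (intro card_of_ordLeqI) auto
qed

lemma ex_underS_ordIso:
  assumes "|K| <o r" "Well_order r"
  shows "\<exists>b\<in>Field r. |K| =o |underS r b|"
proof -
  obtain b where b: "b \<in> Field r" "|K| =o Restr r (underS r b)"
    using ordLess_iff_ordIso_Restr[OF assms(2) card_of_Well_order, THEN iffD1, OF assms(1)] by blast
  have "Field (Restr r (underS r b)) = underS r b"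
    using assms(2) by (intro Refl_Field_Restr2) (auto simp: order_on_defs underS_def Field_def)
  hence "|K| =o |underS r b|"
    using card_of_cong[OF b(2)] by (simp add: Field_card_of)
  thus ?thesis
    using b(1) by blast
qed

text \<open>The order of \<open>'o\<close> is a well-order on \<open>UNIV\<close>, so it is at least
  as long as the cardinal \<open>|UNIV|\<close>; every smaller cardinal is therefore the size of a
  proper initial segment.\<close>

lemma ex_lessThan_ordIso:
  assumes "|X| <o |UNIV :: 'o::wellorder set|"
  shows "\<exists>m::'o. |{..<m}| =o |X|"
proof -
  define W where "W = {(x::'o, y). x \<le> y}"
  have F: "Field W = UNIV"
    by (auto simp: W_def Field_def)
  have wW: "wf (W - Id)"
  proof -
    have "W - Id = {(x, y). x < y}"
      by (auto simp: W_def)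
    thus ?thesis
      using wf by simp
  qed
  have W: "Well_order W"
    unfolding well_order_on_def linear_order_on_def partial_order_on_def preorder_on_def F
    using wW by (auto simp: W_def refl_on_def trans_def antisym_def total_on_def)
  have "|UNIV :: 'o set| \<le>o W"
    using card_of_least[of UNIV W] W F by simp
  hence "|X| <o W"
    using assms ordLess_ordLeq_trans by blast
  then obtain m where "|X| =o |underS W m|"
    using ex_underS_ordIso[OF _ W] by blast
  moreover have "underS W m = {..<m}"
    by (auto simp: underS_def W_def)
  ultimately have "|X| =o |{..<m}|"
    by simp
  thus ?thesis
    using ordIso_symmetric by blast
qed

section \<open>Complete filters\<close>

text \<open>This is closure under intersections of \<open>|I|\<close> sets, that is,
  \<open>|I|\<^sup>+\<close>-completeness. The improper filter is included, so that restricting to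
  an arbitrary set needs no case distinction.\<close>

definition complete_over :: "'i set \<Rightarrow> 'm filter \<Rightarrow> bool" where
  "complete_over I A \<longleftrightarrow>
     (\<forall>P. (\<forall>i\<in>I. eventually (P i) A) \<longrightarrow> eventually (\<lambda>x. \<forall>i\<in>I. P i x) A)"

lemma complete_overD:
  "complete_over I A \<Longrightarrow> (\<And>i. i \<in> I \<Longrightarrow> eventually (P i) A) \<Longrightarrow> eventually (\<lambda>x. \<forall>i\<in>I. P i x) A"
  unfolding complete_over_def by blast

lemma complete_over_mono:
  assumes "complete_over I A" "|J| \<le>o |I|"
  shows "complete_over J A"
  unfolding complete_over_def
proof (intro allI impI)
  fix P assume P: "\<forall>j\<in>J. eventually (P j) A"
  show "\<forall>\<^sub>F x in A. \<forall>j\<in>J. P j x"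
  proof (cases "J = {}")
    case False
    then obtain g where g: "g ` I = J"
      using assms(2) card_of_ordLeq2 by metis
    have "\<forall>\<^sub>F x in A. \<forall>i\<in>I. P (g i) x"
      using assms(1) P g by (intro complete_overD) auto
    thus ?thesis
      using g by (simp flip: g)
  qed simp
qed

lemma complete_over_restrict:
  assumes "complete_over I A"
  shows "complete_over I (inf A (principal Z))"
  unfolding complete_over_def
proof (intro allI impI)
  fix P assume "\<forall>i\<in>I. eventually (P i) (inf A (principal Z))"
  hence "\<forall>\<^sub>F x in A. \<forall>i\<in>I. x \<in> Z \<longrightarrow> P i x"
    by (intro complete_overD[OF assms]) (simp add: eventually_inf_principal)
  thus "\<forall>\<^sub>F x in inf A (principal Z). \<forall>i\<in>I. P i x"
    unfolding eventually_inf_principal by eventually_elim blast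
qed

lemma complete_over_pigeonhole:
  assumes "complete_over I A" "A \<noteq> bot" "\<forall>\<^sub>F x in A. \<exists>i\<in>I. Q i x"
  shows "\<exists>i\<in>I. \<exists>\<^sub>F x in A. Q i x"
proof (rule ccontr)
  assume "\<not> ?thesis"
  hence "\<forall>\<^sub>F x in A. \<forall>i\<in>I. \<not> Q i x"
    by (intro complete_overD[OF assms(1)]) (auto simp: frequently_def)
  with assms(3) have "\<forall>\<^sub>F x in A. False"
    by eventually_elim blast
  thus False
    using assms(2) by (simp add: trivial_limit_def)
qed

text \<open>Along a countably complete proper filter, an infinite descent of functions would descend
  at a single point. This takes the place of the well-foundedness of an ultrapower.\<close>

lemma wf_eventually_less:
  assumes "complete_over (UNIV::nat set) A" "A \<noteq> bot"
  shows "wf {(f, g :: 'm \<Rightarrow> 'o::wellorder). \<forall>\<^sub>F x in A. f x < g x}"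
  unfolding wf_iff_no_infinite_down_chain
proof
  assume "\<exists>f. \<forall>i. (f (Suc i), f i) \<in> {(f, g :: 'm \<Rightarrow> 'o). \<forall>\<^sub>F x in A. f x < g x}"
  then obtain f :: "nat \<Rightarrow> 'm \<Rightarrow> 'o" where f: "\<And>i. \<forall>\<^sub>F x in A. f (Suc i) x < f i x"
    by auto
  have "\<forall>\<^sub>F x in A. \<forall>i\<in>UNIV. f (Suc i) x < f i x"
    using f by (intro complete_overD[OF assms(1)])
  then obtain x where "\<And>i. f (Suc i) x < f i x"
    using eventually_happens'[OF assms(2)] by blast
  moreover obtain k where "(f (Suc k) x, f k x) \<notin> {(a, b). a < b}"
    by (rule wf_no_infinite_down_chainE[OF wf, of "\<lambda>k. f k x"])
  ultimately show False
    by simp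
qed

section \<open>A covering theorem\<close>

text \<open>Every function is tall for the improper filter, so sets that are null for \<open>A\<close> count as reducible below.\<close>

definition tall :: "'l set \<Rightarrow> 'm filter \<Rightarrow> ('m \<Rightarrow> 'o::wellorder) \<Rightarrow> bool" where
  "tall L A h \<longleftrightarrow> (\<forall>P. |P| \<le>o |L| \<longrightarrow>
     (\<exists>\<phi>. (\<forall>\<^sub>F x in A. \<phi> x < h x) \<and> (\<forall>p\<in>P. \<forall>\<^sub>F x in A. \<phi> x \<noteq> p x)))"

text \<open>Each point \<open>x\<close> of the cover picks an index \<open>s x\<close> with
  \<open>x \<in> W (s x)\<close>; the functions \<open>e j\<close>, and the witnesses of tallness
  for a given \<open>P\<close>, are glued along \<open>s\<close>. Each verification combines
  \<open>|J|\<close> conditions, which completeness over \<open>J\<close> permits.\<close>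

lemma tall_glue:
  assumes comp: "complete_over J A"
    and cov: "\<forall>\<^sub>F x in A. \<exists>j\<in>J. x \<in> W j"
    and less: "\<And>j. j \<in> J \<Longrightarrow> \<forall>\<^sub>F x in A. x \<in> W j \<longrightarrow> e j x < h x"
    and tall: "\<And>j. j \<in> J \<Longrightarrow> tall L (inf A (principal (W j))) (e j)"
  shows "\<exists>e'. (\<forall>\<^sub>F x in A. e' x < h x) \<and> tall L A e'"
proof -
  define s where "s x = (SOME j. j \<in> J \<and> x \<in> W j)" for x
  have s: "s x \<in> J \<and> x \<in> W (s x)" if "\<exists>j\<in>J. x \<in> W j" for x
    unfolding s_def using that someI_ex[of "\<lambda>j. j \<in> J \<and> x \<in> W j"] by blast
  define e' where "e' x = e (s x) x" for x
  have "\<forall>\<^sub>F x in A. \<forall>j\<in>J. x \<in> W j \<longrightarrow> e j x < h x"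
    using less by (intro complete_overD[OF comp])
  with cov have 1: "\<forall>\<^sub>F x in A. e' x < h x"
    by eventually_elim (use s in \<open>auto simp: e'_def\<close>)
  have "\<exists>\<phi>. (\<forall>\<^sub>F x in A. \<phi> x < e' x) \<and> (\<forall>p\<in>P. \<forall>\<^sub>F x in A. \<phi> x \<noteq> p x)" if P: "|P| \<le>o |L|" for P
  proof -
    have "\<forall>j\<in>J. \<exists>\<phi>. (\<forall>\<^sub>F x in A. x \<in> W j \<longrightarrow> \<phi> x < e j x) \<and> (\<forall>p\<in>P. \<forall>\<^sub>F x in A. x \<in> W j \<longrightarrow> \<phi> x \<noteq> p x)"
      using tall P unfolding tall_def by (simp add: eventually_inf_principal)
    from bchoice[OF this] obtain \<phi> where
      \<phi>1: "\<And>j. j \<in> J \<Longrightarrow> \<forall>\<^sub>F x in A. x \<in> W j \<longrightarrow> \<phi> j x < e j x" and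
      \<phi>2: "\<And>j p. j \<in> J \<Longrightarrow> p \<in> P \<Longrightarrow> \<forall>\<^sub>F x in A. x \<in> W j \<longrightarrow> \<phi> j x \<noteq> p x"
      by auto
    have "\<forall>\<^sub>F x in A. \<forall>j\<in>J. x \<in> W j \<longrightarrow> \<phi> j x < e j x"
      using \<phi>1 by (intro complete_overD[OF comp])
    with cov have "\<forall>\<^sub>F x in A. \<phi> (s x) x < e' x"
      by eventually_elim (use s in \<open>auto simp: e'_def\<close>)
    moreover have "\<forall>\<^sub>F x in A. \<phi> (s x) x \<noteq> p x" if "p \<in> P" for p
    proof -
      have "\<forall>\<^sub>F x in A. \<forall>j\<in>J. x \<in> W j \<longrightarrow> \<phi> j x \<noteq> p x"
        using \<phi>2[OF _ that] by (intro complete_overD[OF comp])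
      with cov show ?thesis
        by eventually_elim (use s in auto)
    qed
    ultimately show ?thesis
      by (intro exI[of _ "\<lambda>x. \<phi> (s x) x"]) simp
  qed
  with 1 show ?thesis
    unfolding tall_def by (intro exI[of _ e']) simp
qed

section \<open>Complete filters and covers over a tower of iterated power sets\<close>

locale beth_tower =
  fixes D :: "nat \<Rightarrow> 'm set"
  assumes infinite_D0: "infinite (D 0)"
    and Pow_D: "|Pow (D j)| \<le>o |D (Suc j)|"
begin

abbreviation M :: "'m set" where
  "M \<equiv> \<Union>j. D j"

lemma D_ordLess_Suc: "|D j| <o |D (Suc j)|"
  using card_of_Pow Pow_D ordLess_ordLeq_trans by blast

lemma D_mono: "j \<le> k \<Longrightarrow> |D j| \<le>o |D k|"
proof (induction rule: dec_induct)
  case (step k)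
  thus ?case
    using D_ordLess_Suc ordLess_imp_ordLeq ordLeq_transitive by blast
qed (simp add: card_of_refl ordIso_imp_ordLeq)

lemma infinite_D: "infinite (D j)"
  using D_mono[of 0 j] infinite_D0 card_of_ordLeq_finite by blast

lemma D_ordLeq_M: "|D j| \<le>o |M|"
  by (rule card_of_mono1) blast

lemma infinite_M: "infinite M"
  using infinite_D D_ordLeq_M card_of_ordLeq_finite by blast

lemma Pow_ordLeq_D:
  assumes "|X| \<le>o |D j|" "j < n"
  shows "|Pow X| \<le>o |D n|"
proof -
  have "|Pow X| \<le>o |D (Suc j)|"
    using card_of_Pow_mono_ordLeq[OF assms(1)] Pow_D ordLeq_transitive by blast
  thus ?thesis
    using D_mono[of "Suc j" n] assms(2) by (simp add: Suc_leI ordLeq_transitive)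
qed

lemma Pow_Times_ordLeq_D:
  assumes "j < n" "k < n" "|X| \<le>o |D j|" "|Y| \<le>o |D k|"
  shows "|Pow (X \<times> Y)| \<le>o |D n|"
proof (rule Pow_ordLeq_D)
  show "|X \<times> Y| \<le>o |D (max j k)|"
    using ordLeq_transitive[OF assms(3) D_mono[of j "max j k"]]
      ordLeq_transitive[OF assms(4) D_mono[of k "max j k"]]
    by (intro card_of_Times_ordLeq infinite_D) simp_all
qed (use assms in simp)

text \<open>Living on some \<open>D j\<close>, such a filter is determined by its sets inside
  \<open>D j\<close>, so that there are at most \<open>|M|\<close> of them. The index
  \<open>j\<close> is independent of the degree \<open>n\<close> of completeness.\<close>

definition complete_filter :: "nat \<Rightarrow> 'm filter \<Rightarrow> bool" where
  "complete_filter n B \<longleftrightarrow> B \<noteq> bot \<and> complete_over (D n) B \<and> (\<exists>j. B \<le> principal (D j))"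

text \<open>
  This replaces \<open>\<lambda>\<^bsup>[\<kappa>]\<^esup> = \<lambda>\<close> for \<open>\<lambda> = |{..<t}|\<close> and \<open>\<kappa> = |D n|\<close> in Shelah's revised GCH.
\<close>

definition covered :: "nat \<Rightarrow> 'o::wellorder \<Rightarrow> bool" where
  "covered n t \<longleftrightarrow> (\<exists>P :: ('m \<Rightarrow> 'o) set. |P| \<le>o |{..<t}| \<and>
     (\<forall>j \<phi>. (\<forall>x\<in>D j. \<phi> x < t) \<longrightarrow>
        (\<exists>Q\<subseteq>P. |Q| \<le>o |D n| \<and> (\<forall>x\<in>D j. \<exists>q\<in>Q. q x = \<phi> x))))"

lemma covered_mono:
  fixes t :: "'a::wellorder"
  assumes "covered m t" "m \<le> n"
  shows "covered n t"
proof -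
  obtain P :: "('m \<Rightarrow> 'a) set" where P: "|P| \<le>o |{..<t}|"
    "\<And>j \<phi>. \<forall>x\<in>D j. \<phi> x < t \<Longrightarrow> \<exists>Q\<subseteq>P. |Q| \<le>o |D m| \<and> (\<forall>x\<in>D j. \<exists>q\<in>Q. q x = \<phi> x)"
    using assms(1) unfolding covered_def by auto
  have "\<exists>Q\<subseteq>P. |Q| \<le>o |D n| \<and> (\<forall>x\<in>D j. \<exists>q\<in>Q. q x = \<phi> x)" if \<phi>: "\<forall>x\<in>D j. \<phi> x < t" for j \<phi>
  proof -
    obtain Q where Q: "Q \<subseteq> P" "|Q| \<le>o |D m|" "\<forall>x\<in>D j. \<exists>q\<in>Q. q x = \<phi> x"
      using P(2)[OF \<phi>] by auto
    show ?thesis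
      using Q ordLeq_transitive[OF Q(2) D_mono[OF assms(2)]] by (intro exI[of _ Q]) simp
  qed
  with P(1) show ?thesis
    unfolding covered_def by (intro exI[of _ P]) simp
qed

lemma card_of_filters: "|{B. complete_filter n B}| \<le>o |M|"
proof -
  have 1: "|{B. B \<le> principal (D j)}| \<le>o |M|" for j
  proof -
    define c where "c B = {X \<in> Pow (D j). \<forall>\<^sub>F x in B. x \<in> X}" for B
    have "inj_on c {B. B \<le> principal (D j)}"
    proof (rule inj_onI)
      fix A B assume AB: "A \<in> {B. B \<le> principal (D j)}" "B \<in> {B. B \<le> principal (D j)}" "c A = c B"
      have *: "eventually P C \<longleftrightarrow> {x \<in> D j. P x} \<in> c C" if "C \<le> principal (D j)" for P C
      proof -
        have "\<forall>\<^sub>F x in C. x \<in> D j"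
          using that by (simp add: le_principal)
        hence "eventually P C \<longleftrightarrow> (\<forall>\<^sub>F x in C. x \<in> D j \<and> P x)"
          by (simp add: eventually_conj_iff)
        thus ?thesis
          by (auto simp: c_def)
      qed
      show "A = B"
        using AB by (auto simp: filter_eq_iff *)
    qed
    moreover have "c ` {B. B \<le> principal (D j)} \<subseteq> Pow (Pow (D j))"
      by (auto simp: c_def)
    ultimately have "|{B. B \<le> principal (D j)}| \<le>o |Pow (Pow (D j))|"
      by (intro card_of_ordLeqI) auto
    also have "|Pow (Pow (D j))| \<le>o |D (Suc (Suc j))|"
      by (rule Pow_ordLeq_D[OF Pow_D]) simp
    also have "|D (Suc (Suc j))| \<le>o |M|"
      by (rule D_ordLeq_M)
    finally show ?thesis .
  qed
  have "|\<Union>j\<in>UNIV. {B. B \<le> principal (D j)}| \<le>o |M|"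
    using 1 by (intro card_of_UNION_ordLeq_infinite infinite_M card_of_nat_ordLeq) auto
  moreover have "|{B. complete_filter n B}| \<le>o |\<Union>j\<in>UNIV. {B. B \<le> principal (D j)}|"
    by (rule card_of_mono1) (auto simp: complete_filter_def)
  ultimately show ?thesis
    using ordLeq_transitive by blast
qed

text \<open>Hitting sets \<open>H B\<close> for all filters \<open>B\<close> are pooled into
  \<open>P\<close>. If some \<open>\<phi>\<close> on \<open>D j\<close> were not covered by
  \<open>|D n|\<close> members of \<open>P\<close>, the subsets of \<open>D j\<close> on which it is
  so covered would form a proper ideal. Its dual filter \<open>B\<close> is complete, so
  \<open>\<phi>\<close> agrees with some \<open>p \<in> H B\<close> on a positive set, although
  \<open>{p}\<close> covers \<open>\<phi>\<close> there.\<close>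

lemma covered_if_not_tall:
  fixes t :: "'o::wellorder"
  assumes large: "|M| \<le>o |{..<t}|"
    and not_tall: "\<And>B. complete_filter n B \<Longrightarrow> \<not> tall {..<t} B (\<lambda>_. t)"
  shows "covered n t"
proof -
  have "\<forall>B. \<exists>P :: ('m \<Rightarrow> 'o) set. complete_filter n B \<longrightarrow> |P| \<le>o |{..<t}| \<and>
      (\<forall>\<phi>. (\<forall>\<^sub>F x in B. \<phi> x < t) \<longrightarrow> (\<exists>p\<in>P. \<exists>\<^sub>F x in B. \<phi> x = p x))"
    using not_tall unfolding tall_def frequently_def by metis
  then obtain H :: "'m filter \<Rightarrow> ('m \<Rightarrow> 'o) set" where
    H1: "\<And>B. complete_filter n B \<Longrightarrow> |H B| \<le>o |{..<t}|" and
    H2: "\<And>B \<phi>. complete_filter n B \<Longrightarrow> \<forall>\<^sub>F x in B. \<phi> x < t \<Longrightarrow> \<exists>p\<in>H B. \<exists>\<^sub>F x in B. \<phi> x = p x"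
    by metis
  have inf: "infinite {..<t}"
    using large infinite_M card_of_ordLeq_finite by blast
  define P where "P = (\<Union>B\<in>{B. complete_filter n B}. H B)"
  have P: "|P| \<le>o |{..<t}|"
    unfolding P_def
    using ordLeq_transitive[OF card_of_filters large] H1
    by (intro card_of_UNION_ordLeq_infinite inf) auto
  have "\<exists>Q\<subseteq>P. |Q| \<le>o |D n| \<and> (\<forall>x\<in>D j. \<exists>q\<in>Q. q x = \<phi> x)" if \<phi>: "\<forall>x\<in>D j. \<phi> x < t" for j \<phi>
  proof (rule ccontr)
    assume not: "\<not> ?thesis"
    define E where "E R \<longleftrightarrow> (\<exists>Q\<subseteq>P. |Q| \<le>o |D n| \<and> (\<forall>x\<in>D j. \<not> R x \<longrightarrow> (\<exists>q\<in>Q. q x = \<phi> x)))" for R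
    define B where "B = Abs_filter E"
    have filt: "is_filter E"
    proof
      show "E (\<lambda>x. True)"
        unfolding E_def by (rule exI[of _ "{}"]) (simp add: card_of_empty)
    next
      fix R S assume "E R" "E S"
      then obtain Q Q' where Q: "Q \<subseteq> P" "|Q| \<le>o |D n|" "\<forall>x\<in>D j. \<not> R x \<longrightarrow> (\<exists>q\<in>Q. q x = \<phi> x)"
        and Q': "Q' \<subseteq> P" "|Q'| \<le>o |D n|" "\<forall>x\<in>D j. \<not> S x \<longrightarrow> (\<exists>q\<in>Q'. q x = \<phi> x)"
        unfolding E_def by blast
      have "|Q \<union> Q'| \<le>o |D n|"
        using Q(2) Q'(2) by (rule card_of_Un_ordLeq[OF infinite_D])
      thus "E (\<lambda>x. R x \<and> S x)"
        unfolding E_def using Q(1,3) Q'(1,3) by (intro exI[of _ "Q \<union> Q'"]) blast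
    next
      fix R S assume "\<forall>x. R x \<longrightarrow> S x" "E R"
      thus "E S"
        unfolding E_def by meson
    qed
    have ev: "eventually R B \<longleftrightarrow> E R" for R
      unfolding B_def using filt by (rule eventually_Abs_filter)
    have "complete_filter n B"
      unfolding complete_filter_def
    proof (intro conjI exI[of _ j])
      show "B \<noteq> bot"
        using not by (auto simp: trivial_limit_def ev E_def)
      show "B \<le> principal (D j)"
        unfolding le_principal ev E_def by (rule exI[of _ "{}"]) (simp add: card_of_empty)
      show "complete_over (D n) B"
        unfolding complete_over_def
      proof (intro allI impI)
        fix R assume "\<forall>i\<in>D n. eventually (R i) B"
        then obtain Q where Q: "\<And>i. i \<in> D n \<Longrightarrow> Q i \<subseteq> P" "\<And>i. i \<in> D n \<Longrightarrow> |Q i| \<le>o |D n|"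
          "\<And>i x. i \<in> D n \<Longrightarrow> x \<in> D j \<Longrightarrow> \<not> R i x \<Longrightarrow> \<exists>q\<in>Q i. q x = \<phi> x"
          unfolding ev E_def by metis
        let ?Q = "\<Union>i\<in>D n. Q i"
        have "|\<Union>i\<in>D n. Q i| \<le>o |D n|"
          using Q(2) by (intro card_of_UNION_ordLeq_infinite infinite_D)
            (auto simp: card_of_refl ordIso_imp_ordLeq)
        thus "\<forall>\<^sub>F x in B. \<forall>i\<in>D n. R i x"
          unfolding ev E_def
        proof (intro exI[of _ ?Q] conjI ballI impI)
          show "?Q \<subseteq> P"
            using Q(1) by blast
          fix x assume "x \<in> D j" "\<not> (\<forall>i\<in>D n. R i x)"
          thus "\<exists>q\<in>?Q. q x = \<phi> x"
            using Q(3) by fastforce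
        qed
      qed
    qed
    moreover have "\<forall>\<^sub>F x in B. \<phi> x < t"
      using \<phi> unfolding ev E_def by (intro exI[of _ "{}"]) (simp add: card_of_empty)
    ultimately obtain p where p: "p \<in> H B" "\<exists>\<^sub>F x in B. \<phi> x = p x"
      using H2[of B \<phi>] by auto
    have "p \<in> P"
      using p(1) \<open>complete_filter n B\<close> by (auto simp: P_def)
    hence "E (\<lambda>x. \<phi> x \<noteq> p x)"
      unfolding E_def using infinite_D[of n]
      by (intro exI[of _ "{p}"]) (auto intro!: card_of_singl_ordLeq)
    thus False
      using p(2) by (simp add: frequently_def ev)
  qed
  with P show ?thesis
    unfolding covered_def by (intro exI[of _ P]) simp
qed

text \<open>\<open>M\<close> is the union of countably many \<open>D n\<close>, so on a positive set
  \<open>\<phi>\<close> takes values in the image of a single \<open>D n\<close>, and there are only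
  \<open>|M|\<close> functions from some \<open>D j\<close> to such an image. The lemma serves to
  push bounds up to \<open>m0\<close>, where the induction hypothesis applies.\<close>

lemma hit_below_M:
  fixes m :: "'o::wellorder"
  assumes m: "|{..<m}| =o |M|"
  shows "\<exists>P :: ('m \<Rightarrow> 'o) set. |P| \<le>o |M| \<and> (\<forall>A \<phi>. complete_filter 0 A \<longrightarrow>
    (\<forall>\<^sub>F x in A. \<phi> x < m) \<longrightarrow> (\<exists>p\<in>P. \<exists>\<^sub>F x in A. \<phi> x = p x))"
proof -
  obtain u where u: "bij_betw u M {..<m}"
    using card_of_ordIso[THEN iffD2, OF ordIso_symmetric[OF m]] by blast
  define P where "P = (\<Union>j. \<Union>n. Func (D j) (u ` D n))"
  have 1: "|Func (D j) (u ` D n)| \<le>o |M|" for j n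
  proof -
    have "|Func (D j) (u ` D n)| \<le>o |Pow (D j \<times> u ` D n)|"
      by (rule card_of_Func_ordLeq_Pow)
    also have "|Pow (D j \<times> u ` D n)| \<le>o |D (Suc (max j n))|"
      by (rule Pow_Times_ordLeq_D[of j _ n]) (auto simp: card_of_refl ordIso_imp_ordLeq card_of_image)
    also have "|D (Suc (max j n))| \<le>o |M|"
      by (rule D_ordLeq_M)
    finally show ?thesis .
  qed
  have "|P| \<le>o |M|"
    unfolding P_def by (intro card_of_UNION_ordLeq_infinite card_of_nat_ordLeq infinite_M ballI 1)
  moreover have "\<exists>p\<in>P. \<exists>\<^sub>F x in A. \<phi> x = p x"
    if A: "complete_filter 0 A" and \<phi>: "\<forall>\<^sub>F x in A. \<phi> x < m" for A \<phi>
  proof -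
    have comp: "complete_over (UNIV::nat set) A"
      using A infinite_D0 card_of_nat_ordLeq complete_over_mono unfolding complete_filter_def by blast
    obtain j where j: "\<forall>\<^sub>F x in A. x \<in> D j"
      using A unfolding complete_filter_def le_principal by blast
    have "\<exists>n\<in>UNIV. y \<in> u ` D n" if "y < m" for y
    proof -
      have "y \<in> u ` M"
        using u that by (simp add: bij_betw_def)
      thus ?thesis
        unfolding image_UN by (rule UN_E) (rule bexI)
    qed
    hence "\<forall>\<^sub>F x in A. \<exists>n\<in>UNIV. \<phi> x \<in> u ` D n"
      by (rule eventually_mono[OF \<phi>])
    then obtain n where n: "\<exists>\<^sub>F x in A. \<phi> x \<in> u ` D n"
      using complete_over_pigeonhole[OF comp, of "\<lambda>n x. \<phi> x \<in> u ` D n"] A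
      by (auto simp: complete_filter_def)
    obtain d where d: "d \<in> u ` D n"
      using infinite_D[of n] by fastforce
    \<comment> \<open>The value \<open>d\<close> is a filler where \<open>\<phi>\<close> leaves the
      image of \<open>D n\<close>; \<open>undefined\<close> off \<open>D j\<close> is what
      \<open>Func\<close> demands.\<close>
    define p where "p x = (if x \<in> D j then if \<phi> x \<in> u ` D n then \<phi> x else d else undefined)" for x
    have "p \<in> Func (D j) (u ` D n)"
      using d by (auto simp: Func_def p_def)
    hence "p \<in> P"
      by (auto simp: P_def)
    moreover have "\<exists>\<^sub>F x in A. \<phi> x = p x"
      using frequently_eventually_conj[OF n j] by (rule frequently_elim1) (simp add: p_def)
    ultimately show ?thesis
      by blast
  qed
  ultimately show ?thesis
    by (intro exI[of _ P]) simp
qed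

text \<open>
  The conclusion is all that remains of a tall function: \<open>|{..<t}|\<close> functions \<open>g \<beta>\<close> that pairwise
  differ almost everywhere, with an upper bound \<open>e < t\<close> that is not tall off the sets in \<open>R\<close>.
  Here \<open>R\<close> consists of the reducible sets, those on which a minimal tall function \<open>h\<close> can be lowered and stay
  tall; countably many of them cannot cover, since glueing would lower \<open>h\<close> everywhere.
\<close>

lemma tall_imp_bound:
  fixes t m0 :: "'o::wellorder"
  assumes A: "complete_filter 0 A" and tallA: "tall {..<t} A (\<lambda>_. t)"
    and m0: "|{..<m0}| =o |M|" and large: "|M| \<le>o |{..<t}|"
  obtains R :: "'m set \<Rightarrow> bool" and e :: "'m \<Rightarrow> 'o" and g :: "'o \<Rightarrow> 'm \<Rightarrow> 'o" where
    "\<And>W :: nat \<Rightarrow> 'm set. (\<And>k. R (W k)) \<Longrightarrow> \<not> (\<forall>\<^sub>F x in A. \<exists>k. x \<in> W k)"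
    "\<And>Z. \<not> R Z \<Longrightarrow> \<exists>P :: ('m \<Rightarrow> 'o) set. |P| \<le>o |{..<t}| \<and>
       (\<forall>\<phi>. (\<forall>\<^sub>F x in A. x \<in> Z \<longrightarrow> \<phi> x < e x) \<longrightarrow> (\<exists>p\<in>P. \<exists>\<^sub>F x in A. x \<in> Z \<and> \<phi> x = p x))"
    "\<And>\<beta>. \<beta> < t \<Longrightarrow> R {x. e x \<le> g \<beta> x}"
    "\<And>\<beta> \<gamma>. \<beta> < t \<Longrightarrow> \<gamma> < t \<Longrightarrow> \<beta> \<noteq> \<gamma> \<Longrightarrow> \<forall>\<^sub>F x in A. g \<beta> x \<noteq> g \<gamma> x"
    "\<forall>\<^sub>F x in A. m0 \<le> e x \<and> e x < t"
proof -
  let ?L = "{..<t}"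
  obtain a where a: "\<forall>\<^sub>F x in A. x \<in> D a"
    using A unfolding complete_filter_def le_principal by auto
  have Abot: "A \<noteq> bot" and comp0: "complete_over (D 0) A"
    using A unfolding complete_filter_def by auto
  have comp: "complete_over (UNIV::nat set) A"
    using complete_over_mono[OF comp0 card_of_nat_ordLeq[OF infinite_D0]] .
  have infL: "infinite ?L"
    using large infinite_M card_of_ordLeq_finite by blast
  have wf: "wf {(f, g :: 'm \<Rightarrow> 'o). \<forall>\<^sub>F x in A. f x < g x}"
    by (rule wf_eventually_less[OF comp Abot])
  \<comment> \<open>A minimal member \<open>h\<close> of \<open>T\<close> is fixed: nothing below it
    almost everywhere is tall, and since it is at most \<open>t\<close>, it forces
    \<open>e < t\<close> later.\<close>
  define T where "T = {h :: 'm \<Rightarrow> 'o. tall ?L A h \<and> (\<forall>\<^sub>F x in A. h x \<le> t)}"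
  have "(\<lambda>_. t) \<in> T"
    using tallA by (simp add: T_def)
  then obtain h where h: "h \<in> T"
    and min: "\<And>e. (e, h) \<in> {(f, g). \<forall>\<^sub>F x in A. f x < g x} \<Longrightarrow> e \<notin> T"
    by (rule wfE_min[OF wf]) auto
  have tallh: "tall ?L A h" and ht: "\<forall>\<^sub>F x in A. h x \<le> t"
    using h by (auto simp: T_def)
  have not_tall: "\<not> tall ?L A e" if "\<forall>\<^sub>F x in A. e x < h x" for e
  proof
    assume "tall ?L A e"
    moreover have "\<forall>\<^sub>F x in A. e x \<le> t"
      using that ht by eventually_elim auto
    ultimately have "e \<in> T"
      by (simp add: T_def)
    thus False
      using min[of e] that by simp
  qed
  define R where "R W \<longleftrightarrow> (\<exists>e. (\<forall>\<^sub>F x in A. x \<in> W \<longrightarrow> e x < h x) \<and> tall ?L (inf A (principal W)) e)" for W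
  have R1: "\<not> (\<forall>\<^sub>F x in A. \<exists>k. x \<in> W k)" if W: "\<And>k. R (W k)" for W :: "nat \<Rightarrow> 'm set"
  proof
    assume cov: "\<forall>\<^sub>F x in A. \<exists>k. x \<in> W k"
    have "\<forall>k. \<exists>e. (\<forall>\<^sub>F x in A. x \<in> W k \<longrightarrow> e x < h x) \<and> tall ?L (inf A (principal (W k))) e"
      using W by (simp add: R_def)
    from choice[OF this] obtain e where e: "\<And>k. \<forall>\<^sub>F x in A. x \<in> W k \<longrightarrow> e k x < h x" "\<And>k. tall ?L (inf A (principal (W k))) (e k)"
      by auto
    have "\<exists>e'. (\<forall>\<^sub>F x in A. e' x < h x) \<and> tall ?L A e'"
      by (rule tall_glue[OF comp, where W = W and e = e]) (use cov e in auto)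
    thus False
      using not_tall by auto
  qed
  have hit: "\<exists>P :: ('m \<Rightarrow> 'o) set. |P| \<le>o |?L| \<and>
       (\<forall>\<phi>. (\<forall>\<^sub>F x in A. x \<in> Z \<longrightarrow> \<phi> x < e x) \<longrightarrow> (\<exists>p\<in>P. \<exists>\<^sub>F x in A. x \<in> Z \<and> \<phi> x = p x))"
    if "\<not> R Z" "\<forall>\<^sub>F x in A. e x < h x" for Z e
  proof -
    have "\<forall>\<^sub>F x in A. x \<in> Z \<longrightarrow> e x < h x"
      using that(2) by eventually_elim simp
    hence "\<not> tall ?L (inf A (principal Z)) e"
      using that(1) by (auto simp: R_def)
    then obtain P :: "('m \<Rightarrow> 'o) set" where P: "|P| \<le>o |?L|"
      "\<And>\<phi>. \<forall>\<^sub>F x in inf A (principal Z). \<phi> x < e x \<Longrightarrow> \<exists>p\<in>P. \<not> (\<forall>\<^sub>F x in inf A (principal Z). \<phi> x \<noteq> p x)"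
      unfolding tall_def by auto
    show ?thesis
      using P unfolding eventually_inf_principal frequently_def by (intro exI[of _ P]) simp
  qed
  \<comment> \<open>Transfinite recursion: at stage \<open>\<beta>\<close> the earlier functions
    number at most \<open>|{..<t}|\<close>, so the tallness of \<open>h\<close> supplies the next
    one.\<close>
  have "\<exists>g. \<forall>\<beta>. \<beta> < t \<longrightarrow> (\<forall>\<^sub>F x in A. g \<beta> x < h x) \<and> (\<forall>\<gamma><\<beta>. \<forall>\<^sub>F x in A. g \<beta> x \<noteq> g \<gamma> x)"
  proof (rule dependent_wellorder_choice)
    fix r and f f' :: "'o \<Rightarrow> 'm \<Rightarrow> 'o" and \<beta> :: 'o
    assume "\<And>\<gamma>. \<gamma> < \<beta> \<Longrightarrow> f \<gamma> = f' \<gamma>"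
    thus "(\<beta> < t \<longrightarrow> (\<forall>\<^sub>F x in A. r x < h x) \<and> (\<forall>\<gamma><\<beta>. \<forall>\<^sub>F x in A. r x \<noteq> f \<gamma> x)) \<longleftrightarrow>
      (\<beta> < t \<longrightarrow> (\<forall>\<^sub>F x in A. r x < h x) \<and> (\<forall>\<gamma><\<beta>. \<forall>\<^sub>F x in A. r x \<noteq> f' \<gamma> x))"
      by auto
  next
    fix \<beta> :: 'o and f :: "'o \<Rightarrow> 'm \<Rightarrow> 'o"
    show "\<exists>r. \<beta> < t \<longrightarrow> (\<forall>\<^sub>F x in A. r x < h x) \<and> (\<forall>\<gamma><\<beta>. \<forall>\<^sub>F x in A. r x \<noteq> f \<gamma> x)"
    proof (cases "\<beta> < t")
      case True
      have "|f ` {..<\<beta>}| \<le>o |{..<\<beta>}|"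
        by (rule card_of_image)
      also have "|{..<\<beta>}| \<le>o |?L|"
        using True by (intro card_of_mono1) auto
      finally obtain r where "\<forall>\<^sub>F x in A. r x < h x" "\<forall>p\<in>f ` {..<\<beta>}. \<forall>\<^sub>F x in A. r x \<noteq> p x"
        using tallh unfolding tall_def by auto
      thus ?thesis
        by (intro exI[of _ r]) auto
    qed simp
  qed
  then obtain g where g1: "\<And>\<beta>. \<beta> < t \<Longrightarrow> \<forall>\<^sub>F x in A. g \<beta> x < h x"
    and g2: "\<And>\<beta> \<gamma>. \<beta> < t \<Longrightarrow> \<gamma> < \<beta> \<Longrightarrow> \<forall>\<^sub>F x in A. g \<beta> x \<noteq> g \<gamma> x"
    by auto
  have g3: "\<forall>\<^sub>F x in A. g \<beta> x \<noteq> g \<gamma> x" if "\<beta> < t" "\<gamma> < t" "\<beta> \<noteq> \<gamma>" for \<beta> \<gamma>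
  proof (cases "\<gamma> < \<beta>")
    case False
    hence "\<forall>\<^sub>F x in A. g \<gamma> x \<noteq> g \<beta> x"
      using that by (intro g2) auto
    thus ?thesis
      by eventually_elim auto
  qed (use g2 that in auto)
  define H :: "'o \<Rightarrow> 'm set \<Rightarrow> ('m \<Rightarrow> 'o) set" where "H \<beta> Z = (SOME P. |P| \<le>o |?L| \<and>
       (\<forall>\<phi>. (\<forall>\<^sub>F x in A. x \<in> Z \<longrightarrow> \<phi> x < g \<beta> x) \<longrightarrow> (\<exists>p\<in>P. \<exists>\<^sub>F x in A. x \<in> Z \<and> \<phi> x = p x)))" for \<beta> Z
  have H: "|H \<beta> Z| \<le>o |?L| \<and>
       (\<forall>\<phi>. (\<forall>\<^sub>F x in A. x \<in> Z \<longrightarrow> \<phi> x < g \<beta> x) \<longrightarrow> (\<exists>p\<in>H \<beta> Z. \<exists>\<^sub>F x in A. x \<in> Z \<and> \<phi> x = p x))"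
    if "\<beta> < t" "\<not> R Z" for \<beta> Z
    unfolding H_def by (rule someI_ex) (rule hit[OF that(2) g1[OF that(1)]])
  have H1: "|H \<beta> Z| \<le>o |?L|" if "\<beta> < t" "\<not> R Z" for \<beta> Z
    using H[OF that] by simp
  have H2: "\<exists>p\<in>H \<beta> Z. \<exists>\<^sub>F x in A. x \<in> Z \<and> \<phi> x = p x"
    if "\<beta> < t" "\<not> R Z" "\<forall>\<^sub>F x in A. x \<in> Z \<longrightarrow> \<phi> x < g \<beta> x" for \<beta> Z \<phi>
    using H[OF that(1,2)] that(3) by simp
  obtain P0 :: "('m \<Rightarrow> 'o) set" where P0: "|P0| \<le>o |M|"
    "\<And>A \<phi>. complete_filter 0 A \<Longrightarrow> \<forall>\<^sub>F x in A. \<phi> x < m0 \<Longrightarrow> \<exists>p\<in>P0. \<exists>\<^sub>F x in A. \<phi> x = p x"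
    using hit_below_M[OF m0] by auto
  \<comment> \<open>\<open>P\<close> collects what \<open>e\<close> must avoid: \<open>P0\<close>
    forces \<open>m0 \<le> e\<close>, the functions \<open>g \<beta>\<close> turn
    \<open>e \<le> g \<beta>\<close> into a strict inequality, and \<open>H \<beta> Z\<close> makes
    \<open>{x. e x \<le> g \<beta> x}\<close> reducible. Restricting to
    \<open>Z \<subseteq> D a\<close> keeps the number of sets \<open>Z\<close> at most
    \<open>|M|\<close>.\<close>
  define P where "P = P0 \<union> (\<Union>\<beta>\<in>{..<t}. insert (g \<beta>) (\<Union>Z\<in>{Z \<in> Pow (D a). \<not> R Z}. H \<beta> Z))"
  have "|{Z \<in> Pow (D a). \<not> R Z}| \<le>o |Pow (D a)|"
    by (rule card_of_mono1) auto
  also have "|Pow (D a)| \<le>o |D (Suc a)|"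
    by (rule Pow_D)
  also have "|D (Suc a)| \<le>o |M|"
    by (rule D_ordLeq_M)
  also note large
  finally have card_Z: "|{Z \<in> Pow (D a). \<not> R Z}| \<le>o |?L|" .
  have "|P| \<le>o |?L|"
    unfolding P_def using H1
    by (intro card_of_Un_ordLeq[OF infL] card_of_UNION_ordLeq_infinite[OF infL] ballI
        card_of_insert_ordLeq[OF infL] card_Z ordLeq_transitive[OF P0(1) large])
      (auto simp: card_of_refl ordIso_imp_ordLeq)
  then obtain e where e1: "\<forall>\<^sub>F x in A. e x < h x" and e2: "\<And>p. p \<in> P \<Longrightarrow> \<forall>\<^sub>F x in A. e x \<noteq> p x"
    using tallh unfolding tall_def by auto
  have e3: "R {x. e x \<le> g \<beta> x}" if \<beta>: "\<beta> < t" for \<beta>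
  proof (rule ccontr)
    let ?W = "{x. e x \<le> g \<beta> x}"
    \<comment> \<open>Only subsets \<open>Z\<close> of \<open>D a\<close> have their
      \<open>H \<beta> Z\<close> in \<open>P\<close>. As \<open>D a\<close> belongs to the filter,
      cutting down to it does not change the restricted filter.\<close>
    let ?Z = "?W \<inter> D a"
    assume nR: "\<not> R ?W"
    have nR': "\<not> R ?Z"
    proof
      assume "R ?Z"
      then obtain e' where "\<forall>\<^sub>F x in A. x \<in> ?Z \<longrightarrow> e' x < h x" "tall ?L (inf A (principal ?Z)) e'"
        unfolding R_def by auto
      moreover have "inf A (principal ?Z) = inf A (principal ?W)"
        unfolding filter_eq_iff eventually_inf_principal
        by (intro allI iffI; elim eventually_rev_mp; use a in eventually_elim) auto
      moreover have "\<forall>\<^sub>F x in A. x \<in> ?W \<longrightarrow> e' x < h x"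
        using calculation(1) a by eventually_elim auto
      ultimately show False
        using nR by (auto simp: R_def)
    qed
    have "g \<beta> \<in> P"
      using \<beta> by (auto simp: P_def)
    hence "\<forall>\<^sub>F x in A. x \<in> ?Z \<longrightarrow> e x < g \<beta> x"
      by (intro eventually_mono[OF e2]) auto
    from H2[OF \<beta> nR' this] obtain p where p: "p \<in> H \<beta> ?Z" "\<exists>\<^sub>F x in A. x \<in> ?Z \<and> e x = p x"
      by auto
    have "p \<in> P"
      unfolding P_def using p(1) nR' \<beta> by (intro UnI2 UN_I[of \<beta>] insertI2 UN_I[of ?Z]) auto
    hence "\<forall>\<^sub>F x in A. \<not> (x \<in> ?Z \<and> e x = p x)"
      by (intro eventually_mono[OF e2]) auto
    thus False
      using p(2) by (simp add: frequently_def)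
  qed
  have "\<forall>\<^sub>F x in A. m0 \<le> e x"
  proof (rule ccontr)
    assume not: "\<not> (\<forall>\<^sub>F x in A. m0 \<le> e x)"
    \<comment> \<open>If \<open>m0 \<le> e\<close> fails, then \<open>A\<close> restricted to
      \<open>{x. e x < m0}\<close> is again a complete filter, so \<open>e\<close> meets a member of
      \<open>P0\<close> on a positive set.\<close>
    let ?B = "inf A (principal {x. e x < m0})"
    have "?B \<noteq> bot"
      using not by (simp add: trivial_limit_def eventually_inf_principal not_less)
    moreover have "?B \<le> principal (D a)"
      using a by (simp add: le_principal eventually_inf_principal) (erule eventually_mono, simp)
    ultimately have "complete_filter 0 ?B"
      using complete_over_restrict[OF comp0] by (auto simp: complete_filter_def)
    moreover have "\<forall>\<^sub>F x in ?B. e x < m0"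
      by (simp add: eventually_inf_principal)
    ultimately obtain p where p: "p \<in> P0" "\<exists>\<^sub>F x in ?B. e x = p x"
      using P0(2) by auto
    have "p \<in> P"
      using p(1) by (simp add: P_def)
    hence "\<forall>\<^sub>F x in ?B. e x \<noteq> p x"
      unfolding eventually_inf_principal by (intro eventually_mono[OF e2]) auto
    thus False
      using p(2) by (simp add: frequently_def)
  qed
  hence e4: "\<forall>\<^sub>F x in A. m0 \<le> e x \<and> e x < t"
    using e1 ht by eventually_elim auto
  show ?thesis
    using R1 hit[OF _ e1] e3 g3 e4 by (rule that)
qed

text \<open>
  A function \<open>F\<close> into \<open>{..<t}\<close> is coded by the array \<open>g (F x) y\<close>. Each column has values below
  \<open>e y < t\<close>, so by induction it is covered by few codes below \<open>e y\<close>; a filter more complete than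
  the number of columns makes the choice of codes constant in \<open>x\<close>. The resulting row of codes lies
  below \<open>e\<close>, so it meets one of \<open>|{..<t}|\<close> functions on a positive set \<open>V\<close> of columns, and that
  already determines \<open>F x\<close> because the \<open>g \<beta>\<close> differ almost everywhere.
\<close>

lemma bound_imp_covered:
  fixes t m0 :: "'o::wellorder" and g :: "'o \<Rightarrow> 'm \<Rightarrow> 'o" and e :: "'m \<Rightarrow> 'o"
  assumes A: "complete_filter 0 A"
    and m0: "|{..<m0}| =o |M|" and large: "|M| \<le>o |{..<t}|"
    and R1: "\<And>W :: nat \<Rightarrow> 'm set. (\<And>k. R (W k)) \<Longrightarrow> \<not> (\<forall>\<^sub>F x in A. \<exists>k. x \<in> W k)"
    and R2: "\<And>Z. \<not> R Z \<Longrightarrow> \<exists>P :: ('m \<Rightarrow> 'o) set. |P| \<le>o |{..<t}| \<and>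
       (\<forall>\<phi>. (\<forall>\<^sub>F x in A. x \<in> Z \<longrightarrow> \<phi> x < e x) \<longrightarrow> (\<exists>p\<in>P. \<exists>\<^sub>F x in A. x \<in> Z \<and> \<phi> x = p x))"
    and g1: "\<And>\<beta>. \<beta> < t \<Longrightarrow> R {x. e x \<le> g \<beta> x}"
    and g2: "\<And>\<beta> \<gamma>. \<beta> < t \<Longrightarrow> \<gamma> < t \<Longrightarrow> \<beta> \<noteq> \<gamma> \<Longrightarrow> \<forall>\<^sub>F x in A. g \<beta> x \<noteq> g \<gamma> x"
    and e: "\<forall>\<^sub>F x in A. m0 \<le> e x \<and> e x < t"
    and IH: "\<And>s. s < t \<Longrightarrow> m0 \<le> s \<Longrightarrow> \<exists>n. covered n s"
  shows "\<exists>n. covered n t"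
proof -
  let ?L = "{..<t}"
  obtain a where a: "\<forall>\<^sub>F x in A. x \<in> D a"
    using A unfolding complete_filter_def le_principal by auto
  have infL: "infinite ?L"
    using large infinite_M card_of_ordLeq_finite by blast
  \<comment> \<open>The induction hypothesis gives a level \<open>N y\<close> for almost every
    column \<open>y\<close>; \<open>Y k\<close> groups the columns of level \<open>k\<close>, and
    these countably many sets cover almost all columns.\<close>
  define N where "N y = (SOME n. covered n (e y))" for y
  define Y where "Y k = {y \<in> D a. m0 \<le> e y \<and> e y < t \<and> N y = k}" for k
  have N: "covered k (e y)" if "y \<in> Y k" for y k
  proof -
    have "covered (N y) (e y)"
      unfolding N_def by (rule someI_ex) (use that IH in \<open>simp add: Y_def\<close>)
    thus ?thesis
      using that by (simp add: Y_def)
  qed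
  \<comment> \<open>Otherwise every \<open>Y k\<close> is covered by two reducible sets,
    \<open>W k\<close> and \<open>Y k - W k\<close>. Interleaved in the sequence \<open>V\<close>,
    these cover almost everything, against \<open>R1\<close>.\<close>
  have "\<exists>k. \<forall>W. R W \<longrightarrow> \<not> R (Y k - W)"
  proof (rule ccontr)
    assume "\<not> ?thesis"
    hence "\<forall>k. \<exists>W. R W \<and> R (Y k - W)"
      by auto
    from choice[OF this] obtain W where W: "\<And>k. R (W k)" "\<And>k. R (Y k - W k)"
      by auto
    define V where "V i = (if even i then W (i div 2) else Y (i div 2) - W (i div 2))" for i
    have "\<not> (\<forall>\<^sub>F x in A. \<exists>i. x \<in> V i)"
      by (rule R1) (simp add: V_def W)
    moreover have "\<forall>\<^sub>F x in A. \<exists>i. x \<in> V i"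
      using a e
    proof eventually_elim
      case (elim x)
      show ?case
      proof (cases "x \<in> W (N x)")
        case True
        hence "x \<in> V (2 * N x)"
          by (simp add: V_def)
        thus ?thesis ..
      next
        case False
        hence "x \<in> V (2 * N x + 1)"
          using elim by (simp add: V_def Y_def)
        thus ?thesis ..
      qed
    qed
    ultimately show False
      by simp
  qed
  then obtain k where k: "\<And>W. R W \<Longrightarrow> \<not> R (Y k - W)"
    by auto
  \<comment> \<open>\<open>n\<close> exceeds \<open>a\<close> and \<open>k\<close> so that
    \<open>|D n|\<close> bounds the number of possible pairs \<open>col x\<close> below.\<close>
  define n where "n = Suc (max a k)"
  obtain z where z: "z < m0"
  proof -
    have "{..<m0} \<noteq> {}"
      using card_of_ordIso_finite[OF m0] infinite_M by auto
    thus ?thesis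
      using that by auto
  qed
  define H :: "'m set \<Rightarrow> ('m \<Rightarrow> 'o) set" where "H Z = (SOME P. |P| \<le>o |?L| \<and>
       (\<forall>\<phi>. (\<forall>\<^sub>F x in A. x \<in> Z \<longrightarrow> \<phi> x < e x) \<longrightarrow> (\<exists>p\<in>P. \<exists>\<^sub>F x in A. x \<in> Z \<and> \<phi> x = p x)))" for Z
  have H: "|H Z| \<le>o |?L| \<and>
       (\<forall>\<phi>. (\<forall>\<^sub>F x in A. x \<in> Z \<longrightarrow> \<phi> x < e x) \<longrightarrow> (\<exists>p\<in>H Z. \<exists>\<^sub>F x in A. x \<in> Z \<and> \<phi> x = p x))"
    if "\<not> R Z" for Z
    unfolding H_def by (rule someI_ex) (rule R2[OF that])
  define HH where "HH = (\<Union>Z\<in>{Z \<in> Pow (D a). \<not> R Z}. H Z)"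
  have Pow_a: "|Pow (D a)| \<le>o |?L|"
    using ordLeq_transitive[OF ordLeq_transitive[OF Pow_D D_ordLeq_M] large] .
  have "|{Z \<in> Pow (D a). \<not> R Z}| \<le>o |Pow (D a)|"
    by (rule card_of_mono1) auto
  hence card_Z: "|{Z \<in> Pow (D a). \<not> R Z}| \<le>o |?L|"
    using Pow_a by (rule ordLeq_transitive)
  have card_HH: "|HH| \<le>o |?L|"
    unfolding HH_def using H by (intro card_of_UNION_ordLeq_infinite[OF infL] card_Z) auto
  define C where "C y = (SOME P :: ('m \<Rightarrow> 'o) set. |P| \<le>o |{..<e y}| \<and>
     (\<forall>j \<phi>. (\<forall>x\<in>D j. \<phi> x < e y) \<longrightarrow>
        (\<exists>Q\<subseteq>P. |Q| \<le>o |D k| \<and> (\<forall>x\<in>D j. \<exists>q\<in>Q. q x = \<phi> x))))" for y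
  have C: "|C y| \<le>o |{..<e y}| \<and>
     (\<forall>j \<phi>. (\<forall>x\<in>D j. \<phi> x < e y) \<longrightarrow>
        (\<exists>Q\<subseteq>C y. |Q| \<le>o |D k| \<and> (\<forall>x\<in>D j. \<exists>q\<in>Q. q x = \<phi> x)))" if "y \<in> Y k" for y
    unfolding C_def by (rule someI_ex) (use N[OF that] in \<open>simp add: covered_def\<close>)
  \<comment> \<open>Codes in \<open>C y\<close> are numbered by ordinals below \<open>e y\<close>,
    which turns a row of codes into a function below \<open>e\<close>.\<close>
  have "\<forall>y. \<exists>c. y \<in> Y k \<longrightarrow> inj_on c (C y) \<and> c ` C y \<subseteq> {..<e y}"
    using C unfolding card_of_ordLeq[symmetric] by auto
  from choice[OF this] obtain c where c: "\<And>y. y \<in> Y k \<Longrightarrow> inj_on (c y) (C y)"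
    "\<And>y q. y \<in> Y k \<Longrightarrow> q \<in> C y \<Longrightarrow> c y q < e y"
    by auto
  \<comment> \<open>The decoder: the row \<open>p\<close> of numbered codes on the columns in
    \<open>V\<close> is turned back into array entries at \<open>x\<close>, and some
    \<open>\<beta>\<close> is chosen for which \<open>g \<beta>\<close> has these entries.\<close>
  define r where "r = (\<lambda>(p :: 'm \<Rightarrow> 'o, V) x. SOME \<beta>. \<beta> < t \<and> (\<forall>y\<in>V. g \<beta> y = inv_into (C y) (c y) (p y) x))"
  define P where "P = r ` (HH \<times> Pow (D a))"
  have card_P: "|P| \<le>o |?L|"
    unfolding P_def
    by (rule ordLeq_transitive[OF card_of_image card_of_Times_ordLeq[OF infL card_HH Pow_a]])
  have "\<exists>p\<in>P. \<exists>\<^sub>F x in B. F x = p x" if B: "complete_filter n B" and F: "\<forall>\<^sub>F x in B. F x < t" for B F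
  proof -
    obtain b where b: "\<forall>\<^sub>F x in B. x \<in> D b"
      using B unfolding complete_filter_def le_principal by auto
    \<comment> \<open>The array, with entries not below \<open>e y\<close> replaced by
      \<open>z\<close>; this filler is admissible on \<open>Y k\<close> since there
      \<open>z < m0 \<le> e y\<close>.\<close>
    define G where "G x y = (if g (F x) y < e y then g (F x) y else z)" for x y
    have G: "G x y < e y" if "y \<in> Y k" for x y
      using that z by (auto simp: G_def Y_def)
    \<comment> \<open>Column \<open>y\<close> is covered by at most \<open>|D k|\<close> codes,
      which are listed by \<open>D k\<close>; \<open>i x\<close> is the position of a code that is
      correct at \<open>x\<close>.\<close>
    have "\<exists>q i. (\<forall>j. q j \<in> C y) \<and> (\<forall>x\<in>D b. i x \<in> D k \<and> q (i x) x = G x y)" if y: "y \<in> Y k" for y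
    proof -
      obtain Q where Q: "Q \<subseteq> C y" "|Q| \<le>o |D k|" "\<forall>x\<in>D b. \<exists>q\<in>Q. q x = G x y"
        using C[OF y, THEN conjunct2, THEN spec[of _ b], THEN spec[of _ "\<lambda>x. G x y"]] G[OF y] by auto
      have "D b \<noteq> {}"
        using infinite_D[of b] by auto
      hence Q0: "Q \<noteq> {}"
        using Q(3) by auto
      then obtain q where q: "q ` D k = Q"
        using card_of_ordLeq2[OF Q0, THEN iffD2, OF Q(2)] by auto
      obtain q0 where q0: "q0 \<in> Q"
        using Q0 by auto
      have "\<forall>x. \<exists>i. x \<in> D b \<longrightarrow> i \<in> D k \<and> q i x = G x y"
        using Q(3) q by auto
      from choice[OF this] obtain i where i: "\<forall>x\<in>D b. i x \<in> D k \<and> q (i x) x = G x y"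
        by auto
      show ?thesis
        using i q Q(1) q0
        by (intro exI[of _ "\<lambda>j. if j \<in> D k then q j else q0"] exI[of _ i]) auto
    qed
    hence "\<forall>y. \<exists>q i. y \<in> Y k \<longrightarrow> (\<forall>j. q j \<in> C y) \<and> (\<forall>x\<in>D b. i x \<in> D k \<and> q (i x) x = G x y)"
      by auto
    from choice[OF this] obtain q where
      "\<forall>y. \<exists>i. y \<in> Y k \<longrightarrow> (\<forall>j. q y j \<in> C y) \<and> (\<forall>x\<in>D b. i x \<in> D k \<and> q y (i x) x = G x y)"
      by auto
    from choice[OF this] obtain i where
      q: "\<And>y j. y \<in> Y k \<Longrightarrow> q y j \<in> C y" and
      i: "\<And>y x. y \<in> Y k \<Longrightarrow> x \<in> D b \<Longrightarrow> i y x \<in> D k" "\<And>y x. y \<in> Y k \<Longrightarrow> x \<in> D b \<Longrightarrow> q y (i y x) x = G x y"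
      by auto
    \<comment> \<open>\<open>S x\<close> records the columns where row \<open>x\<close> was
      truncated, and \<open>col x\<close> adds the positions of its codes. There are at most
      \<open>|D n|\<close> such records, so on a positive set of \<open>x\<close> they equal those
      of one \<open>x0\<close>.\<close>
    define S where "S x = {y \<in> Y k. e y \<le> g (F x) y}" for x
    define col where "col x = (S x, {(y, j). y \<in> Y k \<and> j = i y x})" for x
    let ?Col = "Pow (D a) \<times> Pow (D a \<times> D k)"
    have comp: "complete_over ?Col B"
    proof (rule complete_over_mono)
      show "complete_over (D n) B"
        using B by (simp add: complete_filter_def)
      show "|?Col| \<le>o |D n|"
      proof (rule card_of_Times_ordLeq[OF infinite_D])
        show "|Pow (D a)| \<le>o |D n|"
          by (rule Pow_ordLeq_D[of _ a]) (simp_all add: n_def card_of_refl ordIso_imp_ordLeq)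
        show "|Pow (D a \<times> D k)| \<le>o |D n|"
          by (rule Pow_Times_ordLeq_D[of a _ k]) (simp_all add: n_def card_of_refl ordIso_imp_ordLeq)
      qed
    qed
    have "\<forall>\<^sub>F x in B. \<exists>s\<in>?Col. x \<in> D b \<and> F x < t \<and> col x = s"
      using b F
    proof eventually_elim
      case (elim x)
      have "col x \<in> ?Col"
        using i(1)[OF _ elim(1)] by (auto simp: col_def S_def Y_def)
      thus ?case
        using elim by auto
    qed
    then obtain s where s: "\<exists>\<^sub>F x in B. x \<in> D b \<and> F x < t \<and> col x = s"
      using complete_over_pigeonhole[OF comp, of "\<lambda>s x. x \<in> D b \<and> F x < t \<and> col x = s"] B
      by (auto simp: complete_filter_def)
    then obtain x0 where x0: "x0 \<in> D b" "F x0 < t" "col x0 = s"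
      using frequently_ex by fastforce
    define Z where "Z = Y k - S x0"
    have Z_eq: "Z = Y k - {y. e y \<le> g (F x0) y}"
      by (auto simp: Z_def S_def)
    have nRZ: "\<not> R Z"
      unfolding Z_eq by (rule k[OF g1[OF x0(2)]])
    have Z_sub: "Z \<subseteq> D a"
      by (auto simp: Z_def Y_def)
    \<comment> \<open>This row of codes is read off at \<open>x0\<close> but serves every
      \<open>x\<close> in the positive set. On \<open>Z\<close> nothing was truncated, and
      \<open>Z\<close> is not reducible by the choice of \<open>k\<close>.\<close>
    define \<psi> where "\<psi> y = c y (q y (i y x0))" for y
    have "\<forall>\<^sub>F y in A. y \<in> Z \<longrightarrow> \<psi> y < e y"
      using c(2) q by (intro always_eventually) (auto simp: \<psi>_def Z_def)
    then obtain p where p: "p \<in> H Z" "\<exists>\<^sub>F y in A. y \<in> Z \<and> \<psi> y = p y"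
      using H[OF nRZ] by auto
    define V where "V = {y \<in> Z. \<psi> y = p y}"
    have "r (p, V) \<in> P"
      unfolding P_def HH_def using p(1) nRZ Z_sub by (intro imageI SigmaI UN_I[of Z]) (auto simp: V_def)
    moreover have "\<exists>\<^sub>F x in B. F x = r (p, V) x"
      using s
    proof (rule frequently_elim1)
      fix x assume x: "x \<in> D b \<and> F x < t \<and> col x = s"
      have Sx: "S x = S x0" and ix: "\<And>y. y \<in> Y k \<Longrightarrow> i y x = i y x0"
        using x x0(3) by (auto simp: col_def set_eq_iff)
      have dec: "g (F x) y = inv_into (C y) (c y) (p y) x" if y: "y \<in> V" for y
      proof -
        have yY: "y \<in> Y k" and "y \<notin> S x" and \<psi>: "p y = \<psi> y"
          using y Sx by (auto simp: V_def Z_def)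
        hence "g (F x) y = G x y"
          by (auto simp: S_def G_def)
        also have "\<dots> = q y (i y x0) x"
          using i(2)[OF yY, of x] ix[OF yY] x by simp
        also have "q y (i y x0) = inv_into (C y) (c y) (p y)"
          unfolding \<psi> \<psi>_def by (rule inv_into_f_f[OF c(1)[OF yY] q[OF yY], symmetric])
        finally show ?thesis .
      qed
      let ?\<beta> = "r (p, V) x"
      have \<beta>: "?\<beta> < t \<and> (\<forall>y\<in>V. g ?\<beta> y = inv_into (C y) (c y) (p y) x)"
        unfolding r_def prod.case by (rule someI_ex) (use dec x in auto)
      show "F x = ?\<beta>"
      proof (rule ccontr)
        assume "F x \<noteq> ?\<beta>"
        hence "\<forall>\<^sub>F y in A. g (F x) y \<noteq> g ?\<beta> y"
          using x \<beta> by (intro g2) auto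
        hence "\<forall>\<^sub>F y in A. \<not> (y \<in> Z \<and> \<psi> y = p y)"
          by eventually_elim (use dec \<beta> in \<open>auto simp: V_def\<close>)
        thus False
          using p(2) by (simp add: frequently_def)
      qed
    qed
    ultimately show ?thesis
      by (intro bexI[of _ "r (p, V)"])
  qed
  hence "covered n t"
    using card_P by (intro covered_if_not_tall[OF large]) (auto simp: tall_def frequently_def)
  thus ?thesis ..
qed

text \<open>Induction on \<open>t\<close>. If the constant function \<open>t\<close> is tall for no
  filter, level 0 suffices; otherwise the remnant \<open>e\<close> of a tall function lies below
  \<open>t\<close>, and the induction hypothesis applies to the values \<open>e y\<close>. The bound
  \<open>m0\<close> keeps these values large enough for it.\<close>

lemma ex_covered:
  fixes t :: "'o::wellorder"
  assumes small: "|M| <o |UNIV :: 'o set|" and large: "|M| \<le>o |{..<t}|"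
  shows "\<exists>n. covered n t"
proof -
  obtain m0 :: 'o where m0: "|{..<m0}| =o |M|"
    using ex_lessThan_ordIso[OF small] by auto
  show ?thesis
    using large
  proof (induction t rule: less_induct)
    case (less t)
    show ?case
    proof (cases "\<exists>A. complete_filter 0 A \<and> tall {..<t} A (\<lambda>_. t)")
      case True
      then obtain A where A: "complete_filter 0 A" "tall {..<t} A (\<lambda>_. t)"
        by auto
      have IH: "\<exists>n. covered n s" if "s < t" "m0 \<le> s" for s
      proof (rule less.IH[OF that(1)])
        have "|M| \<le>o |{..<m0}|"
          by (rule ordIso_imp_ordLeq[OF ordIso_symmetric[OF m0]])
        also have "|{..<m0}| \<le>o |{..<s}|"
          using that(2) by (intro card_of_mono1) auto
        finally show "|M| \<le>o |{..<s}|" .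
      qed
      show ?thesis
      proof (rule tall_imp_bound[OF A m0 less.prems])
        fix R e g
        assume "\<And>W :: nat \<Rightarrow> 'm set. (\<And>k. R (W k)) \<Longrightarrow> \<not> (\<forall>\<^sub>F x in A. \<exists>k. x \<in> W k)"
        "\<And>Z. \<not> R Z \<Longrightarrow> \<exists>P :: ('m \<Rightarrow> 'o) set. |P| \<le>o |{..<t}| \<and>
           (\<forall>\<phi>. (\<forall>\<^sub>F x in A. x \<in> Z \<longrightarrow> \<phi> x < e x) \<longrightarrow> (\<exists>p\<in>P. \<exists>\<^sub>F x in A. x \<in> Z \<and> \<phi> x = p x))"
        "\<And>\<beta>. \<beta> < t \<Longrightarrow> R {x. e x \<le> g \<beta> x}"
        "\<And>\<beta> \<gamma>. \<beta> < t \<Longrightarrow> \<gamma> < t \<Longrightarrow> \<beta> \<noteq> \<gamma> \<Longrightarrow> \<forall>\<^sub>F x in A. g \<beta> x \<noteq> g \<gamma> x"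
        "\<forall>\<^sub>F x in A. m0 \<le> e x \<and> e x < t"
        thus ?thesis
          by (rule bound_imp_covered[OF A(1) m0 less.prems _ _ _ _ _ IH])
      qed
    next
      case False
      thus ?thesis
        using covered_if_not_tall[OF less.prems, of 0] by auto
    qed
  qed
qed

end

section \<open>Splitting families along levels\<close>

lemma card_of_finite_UNION_ordLess:
  assumes "infinite C" "finite I" "\<And>i. i \<in> I \<Longrightarrow> |X i| <o |C|"
  shows "|\<Union>i\<in>I. X i| <o |C|"
  using assms(2,3)
proof (induction I rule: finite_induct)
  case empty
  show ?case
    using assms(1) card_of_empty3 card_of_empty ordLeq_iff_ordLess_or_ordIso
    by (metis (no_types, lifting) SUP_empty card_of_empty_ordIso finite.emptyI ordIso_symmetric)
next
  case (insert i I)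
  thus ?case
    using card_of_Un_ordLess_infinite[OF assms(1), of "X i" "\<Union>i\<in>I. X i"] by simp
qed

lemma card_of_Diff_ordIso:
  assumes "infinite K" "|X| =o |K|" "|X \<inter> U| <o |K|"
  shows "|X - U| =o |K|"
proof -
  have "|X - U| \<le>o |X|"
    by (rule card_of_mono1) auto
  hence le: "|X - U| \<le>o |K|"
    using assms(2) ordLeq_ordIso_trans by blast
  have "\<not> |X - U| <o |K|"
  proof
    assume "|X - U| <o |K|"
    hence "|(X - U) \<union> (X \<inter> U)| <o |K|"
      by (rule card_of_Un_ordLess_infinite[OF assms(1) _ assms(3)])
    moreover have "(X - U) \<union> (X \<inter> U) = X"
      by auto
    ultimately show False
      using assms(2) not_ordLess_ordIso by fastforce
  qed
  thus ?thesis
    using le ordLeq_iff_ordLess_or_ordIso by blast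
qed

lemma card_of_under_ordLess:
  assumes "infinite X" "a \<in> X"
  shows "|under ( |X| ) a| <o |X|"
proof -
  have "|underS ( |X| ) a| <o |X|"
    using assms(2) by (intro card_of_underS) (simp_all add: card_of_card_order_on Field_card_of)
  moreover have "|{a}| <o |X|"
    using assms(1) by (intro finite_ordLess_infinite) (simp_all add: card_of_well_order_on Field_card_of)
  moreover have "under ( |X| ) a \<subseteq> underS ( |X| ) a \<union> {a}"
    by (auto simp: under_def underS_def)
  ultimately show ?thesis
    using card_of_Un_ordLess_infinite[OF assms(1), of "underS ( |X| ) a" "{a}"] card_of_mono1
      ordLeq_ordLess_trans by blast
qed

text \<open>Otherwise \<open>T\<close> injects into the union. No member of the chain contains the
  image, so every member lies inside one of \<open>|T|\<close> members \<open>c x\<close> picked at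
  the points \<open>x\<close> of the image. For infinite \<open>T\<close> their union is too small;
  for finite \<open>T\<close> the image, being finite, lies inside one member after all.\<close>

lemma card_of_chain_Union:
  assumes chain: "\<And>C C'. C \<in> \<C> \<Longrightarrow> C' \<in> \<C> \<Longrightarrow> C \<subseteq> C' \<or> C' \<subseteq> C"
    and small: "\<And>C. C \<in> \<C> \<Longrightarrow> |C| <o |T|"
  shows "|\<Union>\<C>| \<le>o |T|"
proof (rule ccontr)
  assume not: "\<not> ?thesis"
  hence "|T| <o |\<Union>\<C>|"
    by (rule not_ordLeq_iff_ordLess[OF card_of_Well_order card_of_Well_order, THEN iffD1])
  hence "|T| \<le>o |\<Union>\<C>|"
    by (rule ordLess_imp_ordLeq)
  then obtain f where f: "inj_on f T" "f ` T \<subseteq> \<Union>\<C>"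
    unfolding card_of_ordLeq[symmetric] by auto
  have "\<forall>x. \<exists>C. x \<in> f ` T \<longrightarrow> C \<in> \<C> \<and> x \<in> C"
    using f(2) by auto
  from choice[OF this] obtain c where c: "\<And>x. x \<in> f ` T \<Longrightarrow> c x \<in> \<C>" "\<And>x. x \<in> f ` T \<Longrightarrow> x \<in> c x"
    by auto
  have not_sub: "\<not> f ` T \<subseteq> C" if "C \<in> \<C>" for C
  proof
    assume "f ` T \<subseteq> C"
    hence "|T| \<le>o |C|"
      using f(1) unfolding card_of_ordLeq[symmetric] by auto
    thus False
      using small[OF that] not_ordLess_ordLeq by blast
  qed
  have sub: "\<Union>\<C> \<subseteq> (\<Union>x\<in>f ` T. c x)"
  proof
    fix z assume "z \<in> \<Union>\<C>"
    then obtain C where C: "C \<in> \<C>" "z \<in> C"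
      by auto
    then obtain x where x: "x \<in> f ` T" "x \<notin> C"
      using not_sub[OF C(1)] by auto
    hence "C \<subseteq> c x"
      using chain[OF C(1) c(1)[OF x(1)]] c(2)[OF x(1)] by auto
    thus "z \<in> (\<Union>x\<in>f ` T. c x)"
      using C(2) x(1) by auto
  qed
  show False
  proof (cases "finite T")
    case True
    have "\<C> \<noteq> {}"
    proof
      assume "\<C> = {}"
      hence "|\<Union>\<C>| \<le>o |T|"
        by (simp add: card_of_empty)
      thus False
        using not by contradiction
    qed
    moreover have "subset.chain UNIV \<C>"
      using chain by (auto simp: subset_chain_def)
    ultimately obtain C where "C \<in> \<C>" "f ` T \<subseteq> C"
      using finite_subset_Union_chain[of "f ` T" \<C>] True f(2) by auto
    thus False
      using not_sub by auto
  next
    case False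
    have "|\<Union>x\<in>f ` T. c x| \<le>o |T|"
      using small c(1) by (intro card_of_UNION_ordLeq_infinite False card_of_image)
        (auto intro: ordLess_imp_ordLeq)
    thus False
      using not card_of_mono1[OF sub] ordLeq_transitive by blast
  qed
qed

text \<open>Points are chosen one by one along the cardinal well-order of
  \<open>\<F> \<times> K\<close>: fewer than \<open>|K|\<close> have been used before stage
  \<open>(A, k)\<close>, so a new one is left in \<open>A\<close>.\<close>

lemma disjoint_refinement:
  fixes \<F> :: "'a set set" and K :: "'b set"
  assumes inf: "infinite K" and \<F>: "\<And>A. A \<in> \<F> \<Longrightarrow> |A| =o |K|" and small: "|\<F>| \<le>o |K|"
  obtains d where "\<And>A. A \<in> \<F> \<Longrightarrow> d A \<subseteq> A" "\<And>A. A \<in> \<F> \<Longrightarrow> |d A| =o |K|"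
    "\<And>A B. A \<in> \<F> \<Longrightarrow> B \<in> \<F> \<Longrightarrow> A \<noteq> B \<Longrightarrow> d A \<inter> d B = {}"
proof -
  define I where "I = \<F> \<times> K"
  have card_I: "|I| \<le>o |K|"
    unfolding I_def by (rule card_of_Times_ordLeq[OF inf small]) (simp add: card_of_refl ordIso_imp_ordLeq)
  let ?W = "|I| - Id"
  have "wf ?W"
    using card_of_Well_order[of I] by (simp add: order_on_defs)
  hence "\<exists>p. \<forall>z. z \<in> I \<longrightarrow> p z \<in> fst z - p ` underS ( |I| ) z"
  proof (rule dependent_wf_choice)
    fix r and f g :: "'a set \<times> 'b \<Rightarrow> 'a" and z :: "'a set \<times> 'b"
    assume "\<And>y. (y, z) \<in> ?W \<Longrightarrow> f y = g y"
    hence "f ` underS ( |I| ) z = g ` underS ( |I| ) z"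
      by (intro image_cong) (auto simp: underS_def)
    thus "(z \<in> I \<longrightarrow> r \<in> fst z - f ` underS ( |I| ) z) = (z \<in> I \<longrightarrow> r \<in> fst z - g ` underS ( |I| ) z)"
      by simp
  next
    fix z and f :: "'a set \<times> 'b \<Rightarrow> 'a"
    have "\<exists>r. r \<in> fst z - f ` underS ( |I| ) z" if z: "z \<in> I"
    proof (rule ccontr)
      assume "\<not> ?thesis"
      hence "fst z \<subseteq> f ` underS ( |I| ) z"
        by auto
      hence "|fst z| \<le>o |f ` underS ( |I| ) z|"
        by (rule card_of_mono1)
      also have "|f ` underS ( |I| ) z| \<le>o |underS ( |I| ) z|"
        by (rule card_of_image)
      also have "|underS ( |I| ) z| <o |I|"
        using z by (intro card_of_underS) (simp_all add: card_of_card_order_on Field_card_of)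
      also note card_I
      finally have "|fst z| <o |K|" .
      moreover have "|fst z| =o |K|"
        using z by (intro \<F>) (auto simp: I_def)
      ultimately show False
        using not_ordLess_ordIso by blast
    qed
    thus "\<exists>r. z \<in> I \<longrightarrow> r \<in> fst z - f ` underS ( |I| ) z"
      by auto
  qed
  then obtain p where "\<forall>z. z \<in> I \<longrightarrow> p z \<in> fst z - p ` underS ( |I| ) z"
    by (rule exE)
  hence p: "p z \<in> fst z" "p z \<notin> p ` underS ( |I| ) z" if "z \<in> I" for z
    using that by (metis DiffD1, metis DiffD2)
  have inj: "inj_on p I"
  proof (rule inj_onI, rule ccontr)
    fix y z assume yz: "y \<in> I" "z \<in> I" "p y = p z" "y \<noteq> z"
    have "total_on I |I|"
      using card_of_Well_order[of I] by (simp add: order_on_defs Field_card_of)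
    hence "y \<in> underS ( |I| ) z \<or> z \<in> underS ( |I| ) y"
      using yz by (auto simp: total_on_def underS_def)
    thus False
      using p(2)[OF yz(1)] p(2)[OF yz(2)] yz(3) imageI[of _ _ p] by metis
  qed
  show ?thesis
  proof
    fix A assume A: "A \<in> \<F>"
    show "p ` ({A} \<times> K) \<subseteq> A"
      using p(1) A by (force simp: I_def)
    have "inj_on (\<lambda>k. p (A, k)) K"
      using A inj by (auto simp: inj_on_def I_def)
    moreover have "(\<lambda>k. p (A, k)) ` K = p ` ({A} \<times> K)"
      by auto
    ultimately have "bij_betw (\<lambda>k. p (A, k)) K (p ` ({A} \<times> K))"
      by (simp add: bij_betw_def)
    thus "|p ` ({A} \<times> K)| =o |K|"
      by (intro ordIso_symmetric[OF card_of_ordIsoI])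
    fix B assume "B \<in> \<F>" "A \<noteq> B"
    thus "p ` ({A} \<times> K) \<inter> p ` ({B} \<times> K) = {}"
      using inj A by (auto simp: inj_on_def I_def)
  qed
qed

text \<open>The enumeration is kept as a well-order \<open>R\<close>, and \<open>d\<close> is
  indexed by the sets themselves. The bound on \<open>underS R A\<close> forces the order type of
  \<open>R\<close> to be the initial ordinal \<open>|\<F>|\<close>.\<close>

definition splitting :: "'r set \<Rightarrow> 'a set set \<Rightarrow> 'a set rel \<Rightarrow> ('a set \<Rightarrow> 'a set) \<Rightarrow> bool" where
  "splitting K \<F> R d \<longleftrightarrow> Well_order R \<and> Field R = \<F> \<and>
     (\<forall>A\<in>\<F>. |underS R A| <o |\<F>| ) \<and>
     (\<forall>A\<in>\<F>. d A \<subseteq> A \<and> |d A| =o |K| ) \<and>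
     (\<forall>A\<in>\<F>. \<forall>B\<in>underS R A. d B \<inter> d A = {}) \<and>
     (\<forall>A\<in>\<F>. |{B \<in> underS R A. B \<inter> d A \<noteq> {}}| <o |K| )"

text \<open>In the cardinal well-order of \<open>\<F>\<close> every proper initial segment has fewer
  than \<open>|K|\<close> elements, so the last clause of \<open>splitting\<close> is automatic for
  a disjoint refinement.\<close>

lemma splitting_small:
  assumes "infinite K" "\<And>A. A \<in> \<F> \<Longrightarrow> |A| =o |K|" "|\<F>| \<le>o |K|"
  shows "\<exists>R d. splitting K \<F> R d"
proof -
  obtain d where d: "\<And>A. A \<in> \<F> \<Longrightarrow> d A \<subseteq> A" "\<And>A. A \<in> \<F> \<Longrightarrow> |d A| =o |K|"
    "\<And>A B. A \<in> \<F> \<Longrightarrow> B \<in> \<F> \<Longrightarrow> A \<noteq> B \<Longrightarrow> d A \<inter> d B = {}"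
    using disjoint_refinement[OF assms] by metis
  have under: "|underS ( |\<F>| ) A| <o |\<F>|" if "A \<in> \<F>" for A
    using that by (intro card_of_underS) (simp_all add: card_of_card_order_on Field_card_of)
  have sub: "underS ( |\<F>| ) A \<subseteq> \<F> - {A}" for A
    using FieldI1[of _ A "|\<F>|"] by (auto simp: Field_card_of underS_def)
  have "|{B \<in> underS ( |\<F>| ) A. B \<inter> d A \<noteq> {}}| <o |K|" if "A \<in> \<F>" for A
  proof -
    have "|{B \<in> underS ( |\<F>| ) A. B \<inter> d A \<noteq> {}}| \<le>o |underS ( |\<F>| ) A|"
      by (rule card_of_mono1) auto
    also note under[OF that]
    also note assms(3)
    finally show ?thesis .
  qed
  moreover have "\<forall>A\<in>\<F>. \<forall>B\<in>underS ( |\<F>| ) A. d B \<inter> d A = {}"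
    using d(3) sub by blast
  ultimately show ?thesis
    unfolding splitting_def using d(1,2) under
    by (intro exI[of _ "|\<F>|"] exI[of _ d]) (simp add: card_of_well_order_on Field_card_of)
qed

text \<open>Levels are split separately and concatenated in the order \<open>s\<close>. By
  \<open>thin\<close>, removing all points of lower levels from \<open>d A\<close> leaves
  \<open>|K|\<close> points, and then \<open>d' A\<close> can meet only those earlier sets that
  share its level. By \<open>small\<close>, levels and initial segments stay smaller than
  \<open>\<F>\<close>.\<close>

lemma splitting_levels:
  fixes \<l> :: "'a set \<Rightarrow> 'i" and s :: "'i rel"
  assumes inf: "infinite K" and unif: "\<And>A. A \<in> \<F> \<Longrightarrow> |A| =o |K|"
    and wf: "wf s" and trans: "trans s"
    and total: "\<And>A B. A \<in> \<F> \<Longrightarrow> B \<in> \<F> \<Longrightarrow> \<l> A = \<l> B \<or> (\<l> A, \<l> B) \<in> s \<or> (\<l> B, \<l> A) \<in> s"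
    and small: "\<And>A. A \<in> \<F> \<Longrightarrow> |{B \<in> \<F>. \<l> B = \<l> A \<or> (\<l> B, \<l> A) \<in> s}| <o |\<F>|"
    and thin: "\<And>A. A \<in> \<F> \<Longrightarrow> |A \<inter> \<Union>{B \<in> \<F>. (\<l> B, \<l> A) \<in> s}| <o |K|"
    and IH: "\<And>\<G>. \<G> \<subseteq> \<F> \<Longrightarrow> |\<G>| <o |\<F>| \<Longrightarrow> \<exists>R d. splitting K \<G> R d"
  shows "\<exists>R d. splitting K \<F> R d"
proof -
  define lev where "lev i = {B \<in> \<F>. \<l> B = i}" for i
  have "\<exists>R d. splitting K (lev (\<l> A)) R d" if "A \<in> \<F>" for A
  proof (rule IH)
    have "|lev (\<l> A)| \<le>o |{B \<in> \<F>. \<l> B = \<l> A \<or> (\<l> B, \<l> A) \<in> s}|"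
      by (rule card_of_mono1) (auto simp: lev_def)
    also note small[OF that]
    finally show "|lev (\<l> A)| <o |\<F>|" .
  qed (auto simp: lev_def)
  hence "\<forall>i. \<exists>R d. i \<in> \<l> ` \<F> \<longrightarrow> splitting K (lev i) R d"
    by auto
  from choice[OF this] obtain R where "\<forall>i. \<exists>d. i \<in> \<l> ` \<F> \<longrightarrow> splitting K (lev i) (R i) d"
    by auto
  from choice[OF this] obtain D where RD: "\<And>A. A \<in> \<F> \<Longrightarrow> splitting K (lev (\<l> A)) (R (\<l> A)) (D (\<l> A))"
    by auto
  define d where "d A = D (\<l> A) A" for A
  have R: "Well_order (R (\<l> A))" "Field (R (\<l> A)) = lev (\<l> A)" if "A \<in> \<F>" for A
    using RD[OF that] by (auto simp: splitting_def)
  have d: "d A \<subseteq> A" "|d A| =o |K|" "|{B \<in> underS (R (\<l> A)) A. B \<inter> d A \<noteq> {}}| <o |K|" if "A \<in> \<F>" for A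
    using RD[OF that] that by (auto simp: splitting_def d_def lev_def)
  have R_lev: "\<l> B = \<l> A \<and> B \<in> \<F>" if "A \<in> \<F>" "(B, C) \<in> R (\<l> A) \<or> (C, B) \<in> R (\<l> A)" for A B C
    using R(2)[OF that(1)] that(2) by (auto simp: Field_def lev_def)
  have disj: "d B \<inter> d A = {}" if "A \<in> \<F>" "B \<in> underS (R (\<l> A)) A" for A B
  proof -
    have "\<l> B = \<l> A"
      using that R_lev[of A B A] by (auto simp: underS_def)
    thus ?thesis
      using RD[OF that(1)] that by (auto simp: splitting_def d_def lev_def)
  qed
  have irr: "(i, i) \<notin> s" for i
    using wf by simp
  define L where "L = {(A, B). A \<in> \<F> \<and> B \<in> \<F> \<and> ((\<l> A, \<l> B) \<in> s \<or> \<l> A = \<l> B \<and> (A, B) \<in> R (\<l> A))}"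
  have refl: "(A, A) \<in> R (\<l> A)" if "A \<in> \<F>" for A
    using R[OF that] that by (auto simp: order_on_defs refl_on_def lev_def)
  have Field_L: "Field L = \<F>"
    using refl by (auto simp: L_def Field_def)
  have "Refl L"
    unfolding refl_on_def Field_L using refl by (auto simp: L_def)
  moreover have "trans L"
  proof (rule transI)
    fix A B C assume L: "(A, B) \<in> L" "(B, C) \<in> L"
    hence F: "A \<in> \<F>" "C \<in> \<F>"
      by (simp_all add: L_def)
    have "Relation.trans (R (\<l> A))"
      using R(1)[OF F(1)] by (simp add: order_on_defs)
    hence "\<l> A = \<l> B \<Longrightarrow> \<l> B = \<l> C \<Longrightarrow> (A, C) \<in> R (\<l> A)"
      using L irr by (auto simp: L_def intro: transD)
    moreover have "(\<l> A, \<l> B) \<in> s \<Longrightarrow> (\<l> B, \<l> C) \<in> s \<Longrightarrow> (\<l> A, \<l> C) \<in> s"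
      using trans by (rule transD)
    ultimately show "(A, C) \<in> L"
      using L F by (auto simp: L_def)
  qed
  moreover have "antisym L"
  proof (rule antisymI)
    fix A B assume L: "(A, B) \<in> L" "(B, A) \<in> L"
    have "\<not> ((\<l> A, \<l> B) \<in> s \<and> (\<l> B, \<l> A) \<in> s)"
      using transD[OF trans] irr by metis
    hence AB: "(A, B) \<in> R (\<l> A)" "(B, A) \<in> R (\<l> A)" "A \<in> \<F>"
      using L irr by (auto simp: L_def)
    have "antisym (R (\<l> A))"
      using R(1)[OF AB(3)] by (simp add: order_on_defs)
    thus "A = B"
      using AB(1,2) by (rule antisymD)
  qed
  moreover have "Total L"
    unfolding total_on_def Field_L
  proof (intro ballI impI)
    fix A B assume AB: "A \<in> \<F>" "B \<in> \<F>" "A \<noteq> B"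
    show "(A, B) \<in> L \<or> (B, A) \<in> L"
    proof (cases "\<l> A = \<l> B")
      case True
      have "Total (R (\<l> A))"
        using R(1)[OF AB(1)] by (simp add: order_on_defs)
      hence "(A, B) \<in> R (\<l> A) \<or> (B, A) \<in> R (\<l> A)"
        using AB True R(2)[OF AB(1)] by (auto simp: total_on_def lev_def)
      thus ?thesis
        using AB True by (auto simp: L_def)
    next
      case False
      thus ?thesis
        using total[OF AB(1,2)] AB by (auto simp: L_def)
    qed
  qed
  moreover have "wf (L - Id)"
  proof (rule wfI_min)
    fix A Q assume "A \<in> (Q :: 'a set set)"
    show "\<exists>B\<in>Q. \<forall>C. (C, B) \<in> L - Id \<longrightarrow> C \<notin> Q"
    proof (cases "Q \<inter> \<F> = {}")
      case True
      thus ?thesis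
        using \<open>A \<in> Q\<close> by (intro bexI[of _ A]) (auto simp: L_def)
    next
      case False
      then obtain A1 where "\<l> A1 \<in> \<l> ` (Q \<inter> \<F>)"
        by auto
      then obtain i where i: "i \<in> \<l> ` (Q \<inter> \<F>)" "\<And>j. (j, i) \<in> s \<Longrightarrow> j \<notin> \<l> ` (Q \<inter> \<F>)"
        by (rule wfE_min[OF wf]) auto
      then obtain A0 where A0: "A0 \<in> Q" "A0 \<in> \<F>" "\<l> A0 = i"
        by auto
      have "wf (R i - Id)"
        using R(1)[OF A0(2)] A0(3) by (simp add: order_on_defs)
      moreover have "A0 \<in> Q \<inter> lev i"
        using A0 by (simp add: lev_def)
      ultimately obtain B where B: "B \<in> Q \<inter> lev i" "\<And>C. (C, B) \<in> R i - Id \<Longrightarrow> C \<notin> Q \<inter> lev i"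
        by (rule wfE_min) auto
      show ?thesis
      proof (intro bexI[of _ B] allI impI notI)
        fix C assume C: "(C, B) \<in> L - Id" "C \<in> Q"
        have "\<l> B = i" "C \<in> \<F>"
          using B(1) C(1) by (auto simp: lev_def L_def)
        moreover have "(\<l> C, i) \<notin> s"
          using i(2) C(2) \<open>C \<in> \<F>\<close> by auto
        ultimately show False
          using C B(2)[of C] by (auto simp: L_def lev_def)
      qed (use B in auto)
    qed
  qed
  ultimately have WO: "Well_order L"
    using FieldI1 FieldI2 by (auto simp: order_on_defs refl_on_def)
  have under: "underS L A \<subseteq> {B \<in> \<F>. (\<l> B, \<l> A) \<in> s} \<union> underS (R (\<l> A)) A" for A
    using irr by (auto simp: L_def underS_def)
  define d' where "d' A = d A - \<Union>{B \<in> \<F>. (\<l> B, \<l> A) \<in> s}" for A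
  have "|underS L A| <o |\<F>|" if "A \<in> \<F>" for A
  proof -
    have "underS L A \<subseteq> {B \<in> \<F>. \<l> B = \<l> A \<or> (\<l> B, \<l> A) \<in> s}"
      by (auto simp: underS_def L_def)
    hence "|underS L A| \<le>o |{B \<in> \<F>. \<l> B = \<l> A \<or> (\<l> B, \<l> A) \<in> s}|"
      by (rule card_of_mono1)
    also note small[OF that]
    finally show ?thesis .
  qed
  moreover have "d' A \<subseteq> A \<and> |d' A| =o |K|" if "A \<in> \<F>" for A
  proof
    show "d' A \<subseteq> A"
      using d(1)[OF that] by (auto simp: d'_def)
    have "|d A \<inter> \<Union>{B \<in> \<F>. (\<l> B, \<l> A) \<in> s}| \<le>o |A \<inter> \<Union>{B \<in> \<F>. (\<l> B, \<l> A) \<in> s}|"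
      using d(1)[OF that] by (intro card_of_mono1) auto
    also note thin[OF that]
    finally show "|d' A| =o |K|"
      unfolding d'_def by (rule card_of_Diff_ordIso[OF inf d(2)[OF that]])
  qed
  moreover have "d' B \<inter> d' A = {}" if "A \<in> \<F>" "B \<in> underS L A" for A B
  proof (cases "(\<l> B, \<l> A) \<in> s")
    case True
    have "B \<in> \<F>"
      using that(2) by (auto simp: underS_def L_def)
    thus ?thesis
      using True d(1)[of B] by (auto simp: d'_def)
  next
    case False
    hence "B \<in> underS (R (\<l> A)) A"
      using under that(2) by auto
    thus ?thesis
      using disj[OF that(1)] by (auto simp: d'_def)
  qed
  moreover have "|{B \<in> underS L A. B \<inter> d' A \<noteq> {}}| <o |K|" if "A \<in> \<F>" for A
  proof -
    have "{B \<in> underS L A. B \<inter> d' A \<noteq> {}} \<subseteq> {B \<in> underS (R (\<l> A)) A. B \<inter> d A \<noteq> {}}"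
      using under[of A] by (auto simp: d'_def)
    hence "|{B \<in> underS L A. B \<inter> d' A \<noteq> {}}| \<le>o |{B \<in> underS (R (\<l> A)) A. B \<inter> d A \<noteq> {}}|"
      by (rule card_of_mono1)
    also note d(3)[OF that]
    finally show ?thesis .
  qed
  ultimately show ?thesis
    unfolding splitting_def using WO Field_L by (intro exI[of _ L] exI[of _ d']) simp
qed

section \<open>Heavy sets, closed subfamilies and the splitting of large families\<close>

definition heavy :: "'a set set \<Rightarrow> 'k set \<Rightarrow> 'a set set \<Rightarrow> 'a set set" where
  "heavy \<F> T \<G> = {A \<in> \<F>. |T| \<le>o |A \<inter> \<Union>\<G>|}"

lemma heavy_mono: "\<G> \<subseteq> \<H> \<Longrightarrow> heavy \<F> T \<G> \<subseteq> heavy \<F> T \<H>"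
proof
  fix A assume "\<G> \<subseteq> \<H>" and A: "A \<in> heavy \<F> T \<G>"
  hence "|A \<inter> \<Union>\<G>| \<le>o |A \<inter> \<Union>\<H>|"
    by (intro card_of_mono1) auto
  thus "A \<in> heavy \<F> T \<H>"
    using A ordLeq_transitive by (auto simp: heavy_def)
qed

text \<open>The traces \<open>A \<inter> \<Union>\<G>\<close> form a chain; if all had fewer than
  \<open>|T|\<close> elements, their union would have at most \<open>|T|\<close>, which is less than
  \<open>|T'|\<close>. This is where an increasing union loses one level of closedness.\<close>

lemma heavy_chain_Union:
  assumes chain: "\<And>\<G> \<H>. \<G> \<in> \<CC> \<Longrightarrow> \<H> \<in> \<CC> \<Longrightarrow> \<G> \<subseteq> \<H> \<or> \<H> \<subseteq> \<G>"
    and T: "|T| <o |T'|" and A: "A \<in> heavy \<F> T' (\<Union>\<CC>)"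
  shows "\<exists>\<G>\<in>\<CC>. A \<in> heavy \<F> T \<G>"
proof (rule ccontr)
  assume not: "\<not> ?thesis"
  let ?\<C> = "(\<lambda>\<G>. A \<inter> \<Union>\<G>) ` \<CC>"
  have "|\<Union>?\<C>| \<le>o |T|"
  proof (rule card_of_chain_Union)
    fix C C' assume "C \<in> ?\<C>" "C' \<in> ?\<C>"
    then obtain \<G> \<H> where "\<G> \<in> \<CC>" "\<H> \<in> \<CC>" "C = A \<inter> \<Union>\<G>" "C' = A \<inter> \<Union>\<H>"
      by auto
    thus "C \<subseteq> C' \<or> C' \<subseteq> C"
      using chain[of \<G> \<H>] by auto
  next
    fix C assume "C \<in> ?\<C>"
    then obtain \<G> where G: "\<G> \<in> \<CC>" "C = A \<inter> \<Union>\<G>"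
      by auto
    hence "\<not> |T| \<le>o |C|"
      using not A by (auto simp: heavy_def)
    thus "|C| <o |T|"
      by (rule not_ordLeq_iff_ordLess[OF card_of_Well_order card_of_Well_order, THEN iffD1])
  qed
  moreover have "\<Union>?\<C> = A \<inter> \<Union>(\<Union>\<CC>)"
    by auto
  ultimately have "|T'| \<le>o |T|"
    using A ordLeq_transitive by (auto simp: heavy_def)
  thus False
    using T not_ordLess_ordLeq by blast
qed

text \<open>The common frame for finite and infinite \<open>\<nu>\<close>: \<open>T n\<close>
  becomes \<open>{..<k + n}\<close> in the first case and \<open>D (Suc n)\<close> in the second. In
  \<open>few_heavy\<close> the threshold \<open>n\<close> may vary with \<open>\<G>\<close>.\<close>

locale tame_family =
  fixes \<F> :: "'a set set" and K :: "'r set" and T :: "nat \<Rightarrow> 'k set"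
  assumes infinite_K: "infinite K"
    and uniform: "A \<in> \<F> \<Longrightarrow> |A| =o |K|"
    and T_Suc: "|T n| <o |T (Suc n)|"
    and T_K: "|T n| \<le>o |K|"
    and few_heavy: "\<G> \<subseteq> \<F> \<Longrightarrow> |K| \<le>o |\<G>| \<Longrightarrow>
      \<exists>n. \<forall>m\<ge>n. \<forall>\<H>\<subseteq>\<F>. |\<H>| \<le>o |\<G>| \<longrightarrow> |heavy \<F> (T m) \<H>| \<le>o |\<G>|"
begin

definition good :: "nat \<Rightarrow> 'a set set \<Rightarrow> bool" where
  "good n \<G> \<longleftrightarrow> (\<forall>\<H>\<subseteq>\<F>. |\<H>| \<le>o |\<G>| \<longrightarrow> |heavy \<F> (T n) \<H>| \<le>o |\<G>| )"

definition closed_in :: "'a set set \<Rightarrow> nat \<Rightarrow> 'a set set \<Rightarrow> bool" where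
  "closed_in \<E> n \<G> \<longleftrightarrow> heavy \<E> (T n) \<G> \<subseteq> \<G>"

definition cl :: "'a set set \<Rightarrow> nat \<Rightarrow> 'a set set \<Rightarrow> 'a set set" where
  "cl \<E> n \<G> = \<Inter>{\<H>. \<G> \<subseteq> \<H> \<and> \<H> \<subseteq> \<E> \<and> closed_in \<E> n \<H>}"

lemma subset_cl: "\<G> \<subseteq> cl \<E> n \<G>"
  by (auto simp: cl_def)

lemma cl_least: "\<G> \<subseteq> \<H> \<Longrightarrow> \<H> \<subseteq> \<E> \<Longrightarrow> closed_in \<E> n \<H> \<Longrightarrow> cl \<E> n \<G> \<subseteq> \<H>"
  by (auto simp: cl_def)

lemma cl_subset: "\<G> \<subseteq> \<E> \<Longrightarrow> cl \<E> n \<G> \<subseteq> \<E>"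
  by (rule cl_least) (auto simp: closed_in_def heavy_def)

lemma cl_mono: "\<G> \<subseteq> \<H> \<Longrightarrow> cl \<E> n \<G> \<subseteq> cl \<E> n \<H>"
  unfolding cl_def by blast

lemma closed_in_cl: "closed_in \<E> n (cl \<E> n \<G>)"
  unfolding closed_in_def
proof
  fix A assume A: "A \<in> heavy \<E> (T n) (cl \<E> n \<G>)"
  show "A \<in> cl \<E> n \<G>"
    unfolding cl_def
  proof (rule InterI)
    fix \<H> assume H: "\<H> \<in> {\<H>. \<G> \<subseteq> \<H> \<and> \<H> \<subseteq> \<E> \<and> closed_in \<E> n \<H>}"
    hence "cl \<E> n \<G> \<subseteq> \<H>"
      by (intro cl_least) auto
    hence "A \<in> heavy \<E> (T n) \<H>"
      using A heavy_mono by blast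
    thus "A \<in> \<H>"
      using H by (auto simp: closed_in_def)
  qed
qed

lemma closed_in_chain_Union:
  assumes "\<And>\<G> \<H>. \<G> \<in> \<CC> \<Longrightarrow> \<H> \<in> \<CC> \<Longrightarrow> \<G> \<subseteq> \<H> \<or> \<H> \<subseteq> \<G>" "\<And>\<G>. \<G> \<in> \<CC> \<Longrightarrow> closed_in \<E> n \<G>"
  shows "closed_in \<E> (Suc n) (\<Union>\<CC>)"
  unfolding closed_in_def
proof
  fix A assume "A \<in> heavy \<E> (T (Suc n)) (\<Union>\<CC>)"
  then obtain \<G> where "\<G> \<in> \<CC>" "A \<in> heavy \<E> (T n) \<G>"
    using heavy_chain_Union[OF assms(1) T_Suc] by blast
  thus "A \<in> \<Union>\<CC>"
    using assms(2) by (auto simp: closed_in_def)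
qed

lemma card_of_Int_closed_in:
  assumes "closed_in \<E> n \<G>" "A \<in> \<E>" "A \<notin> \<G>"
  shows "|A \<inter> \<Union>\<G>| <o |K|"
proof -
  have "\<not> |T n| \<le>o |A \<inter> \<Union>\<G>|"
    using assms by (auto simp: closed_in_def heavy_def)
  hence "|A \<inter> \<Union>\<G>| <o |T n|"
    by (rule not_ordLeq_iff_ordLess[OF card_of_Well_order card_of_Well_order, THEN iffD1])
  thus ?thesis
    using T_K ordLess_ordLeq_trans by blast
qed

text \<open>Adding the heavy sets for \<open>T n\<close> countably often keeps the size at most
  \<open>|\<G>'|\<close> by \<open>good\<close>, and the union of these stages is closed for
  \<open>Suc n\<close>.\<close>

lemma card_of_cl:
  assumes E: "\<E> \<subseteq> \<F>" and G: "\<G> \<subseteq> \<E>" "|\<G>| \<le>o |\<G>'|" and inf: "infinite \<G>'" and good: "good n \<G>'"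
  shows "|cl \<E> (Suc n) \<G>| \<le>o |\<G>'|"
proof -
  define S where "S k = ((\<lambda>\<H>. \<H> \<union> heavy \<E> (T n) \<H>) ^^ k) \<G>" for k
  have S_0: "S 0 = \<G>" and S_Suc: "S (Suc k) = S k \<union> heavy \<E> (T n) (S k)" for k
    by (simp_all add: S_def)
  have S: "S k \<subseteq> \<E> \<and> |S k| \<le>o |\<G>'|" for k
  proof (induction k)
    case (Suc k)
    have "|heavy \<E> (T n) (S k)| \<le>o |heavy \<F> (T n) (S k)|"
      using E by (intro card_of_mono1) (auto simp: heavy_def)
    also have "|heavy \<F> (T n) (S k)| \<le>o |\<G>'|"
      using good Suc E by (auto simp: good_def)
    finally have "|S (Suc k)| \<le>o |\<G>'|"
      unfolding S_Suc using Suc by (intro card_of_Un_ordLeq[OF inf]) auto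
    thus ?case
      using Suc by (auto simp: S_Suc heavy_def)
  qed (use G S_0 in auto)
  have mono: "S j \<subseteq> S k" if "j \<le> k" for j k
    using that by (induction rule: dec_induct) (auto simp: S_Suc)
  have "closed_in \<E> (Suc n) (\<Union>(range S))"
    unfolding closed_in_def
  proof
    fix A assume A: "A \<in> heavy \<E> (T (Suc n)) (\<Union>(range S))"
    have "\<H> \<subseteq> \<H>' \<or> \<H>' \<subseteq> \<H>" if "\<H> \<in> range S" "\<H>' \<in> range S" for \<H> \<H>'
    proof -
      obtain j k where "\<H> = S j" "\<H>' = S k"
        using \<open>\<H> \<in> range S\<close> \<open>\<H>' \<in> range S\<close> by auto
      thus ?thesis
        using mono[of j k] mono[of k j] by (cases "j \<le> k") auto
    qed
    from heavy_chain_Union[OF this T_Suc A] obtain k where "A \<in> heavy \<E> (T n) (S k)"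
      by auto
    hence "A \<in> S (Suc k)"
      by (simp add: S_Suc)
    thus "A \<in> \<Union>(range S)"
      by blast
  qed
  hence "cl \<E> (Suc n) \<G> \<subseteq> \<Union>(range S)"
    using S S_0 by (intro cl_least UN_least) auto
  hence "|cl \<E> (Suc n) \<G>| \<le>o |\<Union>(range S)|"
    by (rule card_of_mono1)
  also have "|\<Union>(range S)| \<le>o |\<G>'|"
    using S by (intro card_of_UNION_ordLeq_infinite[OF inf] card_of_nat_ordLeq[OF inf]) auto
  finally show ?thesis .
qed

text \<open>
  The threshold \<open>n\<close> in \<open>few_heavy\<close> depends on \<open>|\<G>|\<close>. Either one \<open>n\<close> serves cofinally many
  initial segments of \<open>\<E>\<close>, and their closures form a continuous chain; or the segments for which
  \<open>n\<close> works are bounded for each \<open>n\<close>, and countably many closures exhaust \<open>\<E>\<close>, so that there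
  is no limit stage.
\<close>

lemma splitting_large:
  assumes E: "\<E> \<subseteq> \<F>" and large: "|K| <o |\<E>|"
    and IH: "\<And>\<G>. \<G> \<subseteq> \<E> \<Longrightarrow> |\<G>| <o |\<E>| \<Longrightarrow> \<exists>R d. splitting K \<G> R d"
  shows "\<exists>R d. splitting K \<E> R d"
proof -
  define r where "r = |\<E>|"
  have r: "Well_order r" "Field r = \<E>"
    by (simp_all add: r_def card_of_well_order_on Field_card_of)
  have r_refl: "\<And>A. A \<in> \<E> \<Longrightarrow> (A, A) \<in> r" and r_trans: "trans r" and r_antisym: "antisym r"
    and r_total: "\<And>A B. A \<in> \<E> \<Longrightarrow> B \<in> \<E> \<Longrightarrow> A \<noteq> B \<Longrightarrow> (A, B) \<in> r \<or> (B, A) \<in> r"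
    and r_wf: "wf (r - Id)"
    using r by (auto simp: order_on_defs refl_on_def total_on_def)
  have r_Field: "A \<in> \<E>" "B \<in> \<E>" if "(A, B) \<in> r" for A B
    using that r(2) by (auto simp: Field_def)
  have infE: "infinite \<E>"
    using ordLess_imp_ordLeq[OF large] infinite_K card_of_ordLeq_finite by blast
  have unifE: "|A| =o |K|" if "A \<in> \<E>" for A
    using that uniform E by auto
  define J where "J A = under r A" for A
  have J_sub: "J A \<subseteq> \<E>" for A
    using r_Field by (auto simp: J_def under_def)
  have J_mono: "J A \<subseteq> J B" if "(A, B) \<in> r" for A B
    using that transD[OF r_trans] by (auto simp: J_def under_def)
  have J_self: "A \<in> J A" if "A \<in> \<E>" for A
    using r_refl[OF that] by (simp add: J_def under_def)
  have J_small: "|J A| <o |\<E>|" if "A \<in> \<E>" for A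
    unfolding J_def r_def by (rule card_of_under_ordLess[OF infE that])
  define large_good where "large_good n A \<longleftrightarrow> A \<in> \<E> \<and> |K| \<le>o |J A| \<and> (\<forall>m\<ge>n. good m (J A))" for n A
  \<comment> \<open>The closure of \<open>J A\<close> is bounded by a longer segment
    \<open>J B\<close> at which \<open>n\<close> works, although \<open>n\<close> need not work at
    \<open>J A\<close> itself.\<close>
  have cl_small: "|cl \<E> (Suc n) (J A)| <o |\<E>|" if "(A, B) \<in> r" "large_good n B" for n A B
  proof -
    have "infinite (J B)"
      using that(2) infinite_K card_of_ordLeq_finite unfolding large_good_def by blast
    hence "|cl \<E> (Suc n) (J A)| \<le>o |J B|"
      using that E J_sub by (intro card_of_cl card_of_mono1 J_mono) (auto simp: large_good_def)
    also have "|J B| <o |\<E>|"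
      using that(2) by (intro J_small) (simp add: large_good_def)
    finally show ?thesis .
  qed
  obtain b where b: "b \<in> \<E>" "|K| \<le>o |J b|"
  proof -
    obtain b where b: "b \<in> \<E>" "|K| =o |underS r b|"
      using ex_underS_ordIso[of K r] large r by (auto simp: r_def)
    have "|underS r b| \<le>o |J b|"
      by (rule card_of_mono1) (auto simp: J_def under_def underS_def)
    hence "|K| \<le>o |J b|"
      using b(2) ordIso_ordLeq_trans by blast
    thus thesis
      using that b(1) by blast
  qed
  have ex_good: "\<exists>n. large_good n A" if "(b, A) \<in> r" for A
  proof -
    have A: "|K| \<le>o |J A|"
      using b(2) card_of_mono1[OF J_mono[OF that]] ordLeq_transitive by blast
    have "J A \<subseteq> \<F>"
      using J_sub E by blast
    from few_heavy[OF this A] show ?thesis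
      using A r_Field[OF that] by (simp add: large_good_def good_def)
  qed
  show ?thesis
  proof (cases "\<exists>n. \<forall>A\<in>\<E>. \<exists>B. (A, B) \<in> r \<and> large_good n B")
    case True
    then obtain n where n: "\<And>A. A \<in> \<E> \<Longrightarrow> \<exists>B. (A, B) \<in> r \<and> large_good n B"
      by auto
    define C where "C A = cl \<E> (Suc n) (J A)" for A
    have C_mono: "C A \<subseteq> C B" if "(A, B) \<in> r" for A B
      unfolding C_def by (rule cl_mono[OF J_mono[OF that]])
    \<comment> \<open>The level of \<open>A\<close> is the least stage \<open>B\<close> whose
      closure \<open>C B\<close> contains \<open>A\<close>.\<close>
    have "\<exists>B. B \<in> \<E> \<and> A \<in> C B \<and> (\<forall>B'. B' \<in> \<E> \<and> A \<in> C B' \<longrightarrow> (B, B') \<in> r)" if A: "A \<in> \<E>" for A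
    proof -
      have "A \<in> {B \<in> \<E>. A \<in> C B}"
        using A J_self[OF A] subset_cl[of "J A"] by (auto simp: C_def)
      then obtain B where B: "B \<in> {B \<in> \<E>. A \<in> C B}" "\<And>B'. (B', B) \<in> r - Id \<Longrightarrow> B' \<notin> {B \<in> \<E>. A \<in> C B}"
        by (rule wfE_min[OF r_wf]) auto
      have "(B, B') \<in> r" if "B' \<in> \<E>" "A \<in> C B'" for B'
        using B(2)[of B'] that B(1) r_total[of B B'] r_refl[of B] by auto
      thus ?thesis
        using B(1) by auto
    qed
    hence "\<forall>A. \<exists>B. A \<in> \<E> \<longrightarrow> B \<in> \<E> \<and> A \<in> C B \<and> (\<forall>B'. B' \<in> \<E> \<and> A \<in> C B' \<longrightarrow> (B, B') \<in> r)"
      by auto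
    from choice[OF this] obtain \<l> where \<l>: "\<And>A. A \<in> \<E> \<Longrightarrow> \<l> A \<in> \<E>" "\<And>A. A \<in> \<E> \<Longrightarrow> A \<in> C (\<l> A)"
      "\<And>A B. A \<in> \<E> \<Longrightarrow> B \<in> \<E> \<Longrightarrow> A \<in> C B \<Longrightarrow> (\<l> A, B) \<in> r"
      by auto
    have C_sub: "C A \<subseteq> \<E>" for A
      unfolding C_def by (rule cl_subset[OF J_sub])
    have le_iff: "(\<l> A, B) \<in> r \<longleftrightarrow> A \<in> C B" if "A \<in> \<E>" "B \<in> \<E>" for A B
      using \<l>(2)[OF that(1)] \<l>(3)[OF that] C_mono by blast
    show ?thesis
    proof (rule splitting_levels[where \<l> = \<l> and s = "r - Id",
          OF infinite_K unifE r_wf trans_diff_Id[OF r_trans r_antisym] _ _ _ IH])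
      show "\<l> A = \<l> B \<or> (\<l> A, \<l> B) \<in> r - Id \<or> (\<l> B, \<l> A) \<in> r - Id" if "A \<in> \<E>" "B \<in> \<E>" for A B
        using r_total[OF \<l>(1)[OF that(1)] \<l>(1)[OF that(2)]] by auto
      show "|{B \<in> \<E>. \<l> B = \<l> A \<or> (\<l> B, \<l> A) \<in> r - Id}| <o |\<E>|" if A: "A \<in> \<E>" for A
      proof -
        have "{B \<in> \<E>. \<l> B = \<l> A \<or> (\<l> B, \<l> A) \<in> r - Id} \<subseteq> C (\<l> A)"
        proof
          fix B assume B: "B \<in> {B \<in> \<E>. \<l> B = \<l> A \<or> (\<l> B, \<l> A) \<in> r - Id}"
          hence "(\<l> B, \<l> A) \<in> r"
            using r_refl[OF \<l>(1)[OF A]] by auto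
          thus "B \<in> C (\<l> A)"
            using le_iff[OF _ \<l>(1)[OF A]] B by auto
        qed
        hence "|{B \<in> \<E>. \<l> B = \<l> A \<or> (\<l> B, \<l> A) \<in> r - Id}| \<le>o |C (\<l> A)|"
          by (rule card_of_mono1)
        also obtain B where "(\<l> A, B) \<in> r" "large_good n B"
          using n[OF \<l>(1)[OF A]] by auto
        hence "|C (\<l> A)| <o |\<E>|"
          unfolding C_def by (rule cl_small)
        finally show ?thesis .
      qed
      show "|A \<inter> \<Union>{B \<in> \<E>. (\<l> B, \<l> A) \<in> r - Id}| <o |K|" if A: "A \<in> \<E>" for A
      proof (rule card_of_Int_closed_in[OF _ A])
        \<comment> \<open>The sets of lower level are exactly the union of the chain of earlier
          closures, hence closed for \<open>Suc (Suc n)\<close>; this treats successor and limit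
          stages alike.\<close>
        have eq: "{B \<in> \<E>. (\<l> B, \<l> A) \<in> r - Id} = \<Union>(C ` {B. (B, \<l> A) \<in> r - Id})"
        proof (intro equalityI subsetI)
          fix B assume "B \<in> {B \<in> \<E>. (\<l> B, \<l> A) \<in> r - Id}"
          thus "B \<in> \<Union>(C ` {B. (B, \<l> A) \<in> r - Id})"
            using \<l>(2) by auto
        next
          fix B assume "B \<in> \<Union>(C ` {B. (B, \<l> A) \<in> r - Id})"
          then obtain B' where B': "(B', \<l> A) \<in> r - Id" "B \<in> C B'"
            by auto
          have B: "B \<in> \<E>"
            using B'(2) C_sub by auto
          hence le: "(\<l> B, B') \<in> r"
            using B' r_Field by (intro \<l>(3)) auto
          have "(\<l> B, \<l> A) \<in> r"
            by (rule transD[OF r_trans le]) (use B'(1) in simp)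
          moreover have "\<l> B \<noteq> \<l> A"
          proof
            assume "\<l> B = \<l> A"
            hence "\<l> A = B'"
              using B'(1) le by (intro antisymD[OF r_antisym]) simp_all
            thus False
              using B'(1) by simp
          qed
          ultimately have "(\<l> B, \<l> A) \<in> r - Id"
            by simp
          thus "B \<in> {B \<in> \<E>. (\<l> B, \<l> A) \<in> r - Id}"
            using B by auto
        qed
        show "closed_in \<E> (Suc (Suc n)) {B \<in> \<E>. (\<l> B, \<l> A) \<in> r - Id}"
          unfolding eq
        proof (rule closed_in_chain_Union)
          fix \<G> \<H> assume "\<G> \<in> C ` {B. (B, \<l> A) \<in> r - Id}" "\<H> \<in> C ` {B. (B, \<l> A) \<in> r - Id}"
          then obtain B B' where B: "\<G> = C B" "\<H> = C B'" "B \<in> \<E>" "B' \<in> \<E>"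
            using r_Field by auto
          thus "\<G> \<subseteq> \<H> \<or> \<H> \<subseteq> \<G>"
            using r_total[of B B'] C_mono by (cases "B = B'") auto
        qed (auto simp: C_def closed_in_cl)
        show "A \<notin> {B \<in> \<E>. (\<l> B, \<l> A) \<in> r - Id}"
          by simp
      qed
    qed
  next
    case False
    hence "\<forall>n. \<exists>A. A \<in> \<E> \<and> (\<forall>B. (A, B) \<in> r \<longrightarrow> \<not> large_good n B)"
      by auto
    from choice[OF this] obtain a where a: "\<And>n. a n \<in> \<E>" "\<And>n B. (a n, B) \<in> r \<Longrightarrow> \<not> large_good n B"
      by auto
    \<comment> \<open>\<open>c n\<close> is the larger of \<open>a n\<close> and \<open>b\<close>:
      from there on \<open>n\<close> never works, while some other threshold \<open>m n\<close> does
      work at \<open>c n\<close>.\<close>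
    define c where "c n = (if (a n, b) \<in> r then b else a n)" for n
    have c: "(a n, c n) \<in> r" "(b, c n) \<in> r" for n
      using r_total[OF a(1) b(1), of n] r_refl a(1) b(1) by (auto simp: c_def)
    have "\<forall>n. \<exists>m. large_good m (c n)"
      using ex_good c(2) by auto
    from choice[OF this] obtain m where m: "\<And>n. large_good (m n) (c n)"
      by auto
    define C where "C n = cl \<E> (Suc (m n)) (J (c n))" for n
    have C_small: "|C n| <o |\<E>|" for n
      unfolding C_def using r_refl r_Field[OF c(2)] m by (intro cl_small[of "c n" "c n"]) auto
    \<comment> \<open>A set outside every \<open>C n\<close> would lie above all \<open>c n\<close>,
      so no \<open>n\<close> could work at it, against \<open>ex_good\<close>.\<close>
    have ex: "\<exists>n. A \<in> C n" if A: "A \<in> \<E>" for A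
    proof (rule ccontr)
      assume not: "\<not> ?thesis"
      have le: "(c n, A) \<in> r" for n
      proof (rule ccontr)
        assume "(c n, A) \<notin> r"
        hence "A \<in> J (c n)"
          using r_total[of A "c n"] A r_Field[OF c(2)] r_refl[OF A] by (cases "A = c n") (auto simp: J_def under_def)
        hence "A \<in> C n"
          unfolding C_def by (rule subset_cl[THEN subsetD])
        thus False
          using not by auto
      qed
      have "(b, A) \<in> r"
        using transD[OF r_trans c(2) le] .
      then obtain n where "large_good n A"
        using ex_good by auto
      moreover have "(a n, A) \<in> r"
        using transD[OF r_trans c(1) le] .
      ultimately show False
        using a(2) by auto
    qed
    define \<l> where "\<l> A = (LEAST n. A \<in> C n)" for A
    have \<l>: "A \<in> C (\<l> A)" if "A \<in> \<E>" for A
      unfolding \<l>_def using ex[OF that] by (rule LeastI_ex)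
    have not_C: "A \<notin> C n" if "n < \<l> A" for A n
      using that not_less_Least by (auto simp: \<l>_def)
    show ?thesis
    proof (rule splitting_levels[where \<l> = \<l> and s = less_than,
          OF infinite_K unifE wf_less_than trans_less_than _ _ _ IH])
      show "|{B \<in> \<E>. \<l> B = \<l> A \<or> (\<l> B, \<l> A) \<in> less_than}| <o |\<E>|" for A
      proof -
        have "|{B \<in> \<E>. \<l> B = \<l> A \<or> (\<l> B, \<l> A) \<in> less_than}| \<le>o |\<Union>n\<in>{..\<l> A}. C n|"
        proof (intro card_of_mono1 subsetI)
          fix B assume "B \<in> {B \<in> \<E>. \<l> B = \<l> A \<or> (\<l> B, \<l> A) \<in> less_than}"
          thus "B \<in> (\<Union>n\<in>{..\<l> A}. C n)"
            using \<l> by (intro UN_I[of "\<l> B"]) auto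
        qed
        also have "|\<Union>n\<in>{..\<l> A}. C n| <o |\<E>|"
          using C_small by (intro card_of_finite_UNION_ordLess[OF infE]) auto
        finally show ?thesis .
      qed
      \<comment> \<open>Only finitely many closures precede the level of \<open>A\<close>, each
        closed for its own threshold and meeting \<open>A\<close> in fewer than \<open>|K|\<close>
        points, so the varying \<open>m n\<close> do no harm.\<close>
      show "|A \<inter> \<Union>{B \<in> \<E>. (\<l> B, \<l> A) \<in> less_than}| <o |K|" if A: "A \<in> \<E>" for A
      proof -
        have "A \<inter> \<Union>{B \<in> \<E>. (\<l> B, \<l> A) \<in> less_than} \<subseteq> (\<Union>n\<in>{..<\<l> A}. A \<inter> \<Union>(C n))"
        proof
          fix x assume "x \<in> A \<inter> \<Union>{B \<in> \<E>. (\<l> B, \<l> A) \<in> less_than}"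
          then obtain B where "x \<in> A" "x \<in> B" "B \<in> \<E>" "\<l> B < \<l> A"
            by auto
          thus "x \<in> (\<Union>n\<in>{..<\<l> A}. A \<inter> \<Union>(C n))"
            using \<l>[of B] by (intro UN_I[of "\<l> B"]) auto
        qed
        hence "|A \<inter> \<Union>{B \<in> \<E>. (\<l> B, \<l> A) \<in> less_than}| \<le>o |\<Union>n\<in>{..<\<l> A}. A \<inter> \<Union>(C n)|"
          by (rule card_of_mono1)
        also have "|\<Union>n\<in>{..<\<l> A}. A \<inter> \<Union>(C n)| <o |K|"
        proof (rule card_of_finite_UNION_ordLess[OF infinite_K])
          fix n assume "n \<in> {..<\<l> A}"
          thus "|A \<inter> \<Union>(C n)| <o |K|"
            using A not_C closed_in_cl by (intro card_of_Int_closed_in) (auto simp: C_def)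
        qed simp
        finally show ?thesis .
      qed
    qed auto
  qed
qed

lemma ex_splitting: "\<E> \<subseteq> \<F> \<Longrightarrow> \<exists>R d. splitting K \<E> R d"
proof (induction "|\<E>|" arbitrary: \<E> rule: wf_induct_rule[OF wf_ordLess])
  case (1 \<E>)
  show ?case
  proof (cases "|\<E>| \<le>o |K|")
    case True
    thus ?thesis
      using "1.prems" uniform by (intro splitting_small[OF infinite_K]) auto
  next
    case False
    hence large: "|K| <o |\<E>|"
      by (rule not_ordLeq_iff_ordLess[OF card_of_Well_order card_of_Well_order, THEN iffD1])
    show ?thesis
    proof (rule splitting_large[OF "1.prems" large])
      fix \<G> assume "\<G> \<subseteq> \<E>" "|\<G>| <o |\<E>|"
      thus "\<exists>R d. splitting K \<G> R d"
        by (intro "1.hyps") (use "1.prems" in auto)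
    qed
  qed
qed

end

section \<open>Few sets are heavy\<close>

text \<open>A copy of \<open>'a\<close> well-ordered as a cardinal, so that its elements can play the role of ordinals.\<close>

typedef 'a wo = "UNIV :: 'a set"
  by simp

instantiation wo :: (type) wellorder
begin

definition less_eq_wo :: "'a wo \<Rightarrow> 'a wo \<Rightarrow> bool" where
  "x \<le> y \<longleftrightarrow> (Rep_wo x, Rep_wo y) \<in> |UNIV :: 'a set|"

definition less_wo :: "'a wo \<Rightarrow> 'a wo \<Rightarrow> bool" where
  "x < y \<longleftrightarrow> (Rep_wo x, Rep_wo y) \<in> |UNIV :: 'a set| - Id"

instance
proof
  have W: "refl_on UNIV |UNIV :: 'a set|" "trans |UNIV :: 'a set|" "antisym |UNIV :: 'a set|"
    "total_on UNIV |UNIV :: 'a set|" "wf ( |UNIV :: 'a set| - Id)"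
    using card_of_well_order_on[of "UNIV :: 'a set"] by (auto simp: order_on_defs)
  fix x y z :: "'a wo"
  show "x < y \<longleftrightarrow> x \<le> y \<and> \<not> y \<le> x"
    unfolding less_eq_wo_def less_wo_def
    using W(1) antisymD[OF W(3), of "Rep_wo x" "Rep_wo y"] by (auto simp: refl_on_def Rep_wo_inject)
  show "x \<le> x"
    using W(1) by (simp add: less_eq_wo_def refl_on_def)
  show "x \<le> y \<Longrightarrow> y \<le> z \<Longrightarrow> x \<le> z"
    unfolding less_eq_wo_def by (rule transD[OF W(2)])
  show "x \<le> y \<Longrightarrow> y \<le> x \<Longrightarrow> x = y"
    unfolding less_eq_wo_def using antisymD[OF W(3)] by (simp flip: Rep_wo_inject)
  show "x \<le> y \<or> y \<le> x"
    using W(1,4) unfolding less_eq_wo_def refl_on_def total_on_def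
    by (cases "Rep_wo x = Rep_wo y") auto
  fix P and a :: "'a wo"
  assume step: "\<And>x :: 'a wo. (\<And>y. y < x \<Longrightarrow> P y) \<Longrightarrow> P x"
  have "P (Abs_wo u)" for u
    using W(5)
  proof (induction u rule: wf_induct_rule)
    case (less u)
    show ?case
    proof (rule step)
      fix y assume "y < Abs_wo u"
      hence "P (Abs_wo (Rep_wo y))"
        by (intro less) (simp add: less_wo_def Abs_wo_inverse)
      thus "P y"
        by (simp add: Rep_wo_inverse)
    qed
  qed
  from this[of "Rep_wo a"] show "P a"
    by (simp add: Rep_wo_inverse)
qed

end

section \<open>Counting heavy sets through the small sets that they contain\<close>

lemma card_of_heavy_ordLeq:
  assumes inf: "infinite \<G>" and card_S: "|\<S>| \<le>o |\<G>|"
    and few: "\<And>S. S \<in> \<S> \<Longrightarrow> |{A \<in> \<F>. S \<subseteq> A}| \<le>o |\<G>|"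
    and S: "\<And>A. A \<in> \<F> \<Longrightarrow> |T| \<le>o |A \<inter> \<Union>\<H>| \<Longrightarrow> \<exists>S\<in>\<S>. S \<subseteq> A"
  shows "|heavy \<F> T \<H>| \<le>o |\<G>|"
proof -
  have "|heavy \<F> T \<H>| \<le>o |\<Union>S\<in>\<S>. {A \<in> \<F>. S \<subseteq> A}|"
    using S by (intro card_of_mono1) (auto simp: heavy_def)
  also have "|\<Union>S\<in>\<S>. {A \<in> \<F>. S \<subseteq> A}| \<le>o |\<G>|"
    using few by (intro card_of_UNION_ordLeq_infinite[OF inf card_S]) auto
  finally show ?thesis .
qed

lemma card_of_Union_ordLeq:
  assumes "infinite \<G>" "|\<H>| \<le>o |\<G>|" "\<And>A. A \<in> \<H> \<Longrightarrow> |A| \<le>o |\<G>|"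
  shows "|\<Union>\<H>| \<le>o |\<G>|"
  using card_of_UNION_ordLeq_infinite[OF assms(1,2), of "\<lambda>A. A"] assms(3) by simp

text \<open>A set \<open>A\<close> heavy for \<open>D (Suc m)\<close> contains an injective image of
  \<open>D (Suc m)\<close>, covered by \<open>|D m|\<close> functions of \<open>P\<close>. As
  \<open>|D m|\<close> is less than \<open>|D (Suc m)|\<close>, one of them is correct on a set
  \<open>W\<close> of at least \<open>|D 0|\<close> points. So \<open>A\<close> contains one of at
  most \<open>|\<G>|\<close> sets \<open>S (q, W)\<close>, each contained in at most
  \<open>|K|\<close> members of \<open>\<F>\<close>.\<close>

lemma (in beth_tower) few_heavy_infinite:
  fixes \<F> \<G> :: "'a set set" and K :: "'r set"
  assumes inf: "infinite K" and M_K: "|M| \<le>o |K|"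
    and uniform: "\<And>A. A \<in> \<F> \<Longrightarrow> |A| \<le>o |K|"
    and few: "\<And>S. |D 0| \<le>o |S| \<Longrightarrow> |{A \<in> \<F>. S \<subseteq> A}| \<le>o |K|"
    and G: "|K| \<le>o |\<G>|"
  shows "\<exists>n. \<forall>m\<ge>n. \<forall>\<H>\<subseteq>\<F>. |\<H>| \<le>o |\<G>| \<longrightarrow> |heavy \<F> (D (Suc m)) \<H>| \<le>o |\<G>|"
proof -
  have infG: "infinite \<G>"
    using inf G card_of_ordLeq_finite by blast
  have M_G: "|M| \<le>o |\<G>|"
    using M_K G by (rule ordLeq_transitive)
  \<comment> \<open>One more power set leaves room for an ordinal \<open>t\<close> of cardinality
    \<open>|\<G>|\<close>, even if \<open>\<G>\<close> is as large as its type.\<close>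
  have "|\<G>| \<le>o |UNIV :: 'a set set|"
    by (rule card_of_mono1) simp
  also have "|UNIV :: 'a set set| <o |UNIV :: 'a set set set|"
    using card_of_Pow[of "UNIV :: 'a set set"] by simp
  also have "|UNIV :: 'a set set set| \<le>o |UNIV :: 'a set set wo set|"
    by (rule card_of_ordLeqI[of Abs_wo]) (simp_all add: inj_on_def Abs_wo_inject)
  finally have lessG: "|\<G>| <o |UNIV :: 'a set set wo set|" .
  obtain t :: "'a set set wo" where t: "|{..<t}| =o |\<G>|"
    using ex_lessThan_ordIso[OF lessG] by auto
  have G_t: "|\<G>| \<le>o |{..<t}|"
    by (rule ordIso_imp_ordLeq[OF ordIso_symmetric[OF t]])
  obtain n where n: "covered n t"
    using ex_covered[OF ordLeq_ordLess_trans[OF M_G lessG] ordLeq_transitive[OF M_G G_t]] by auto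
  show ?thesis
  proof (intro exI[of _ n] allI impI)
    fix m \<H> assume m: "n \<le> m" and H: "\<H> \<subseteq> \<F>" "|\<H>| \<le>o |\<G>|"
    obtain P :: "('m \<Rightarrow> 'a set set wo) set" where P: "|P| \<le>o |{..<t}|"
      "\<forall>j \<phi>. (\<forall>x\<in>D j. \<phi> x < t) \<longrightarrow> (\<exists>Q\<subseteq>P. |Q| \<le>o |D m| \<and> (\<forall>x\<in>D j. \<exists>q\<in>Q. q x = \<phi> x))"
      using covered_mono[OF n m] unfolding covered_def by auto
    have "|\<Union>\<H>| \<le>o |\<G>|"
      using H uniform ordLeq_transitive[OF _ G] by (intro card_of_Union_ordLeq[OF infG]) auto
    hence "|\<Union>\<H>| \<le>o |{..<t}|"
      using G_t by (rule ordLeq_transitive)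
    then obtain u where u: "inj_on u (\<Union>\<H>)" "u ` \<Union>\<H> \<subseteq> {..<t}"
      unfolding card_of_ordLeq[symmetric] by auto
    \<comment> \<open>\<open>S (q, W)\<close> decodes the values of \<open>q\<close> on
      \<open>W\<close> to points of \<open>\<Union>\<H>\<close>. Only results with at least
      \<open>|D 0|\<close> points enter \<open>\<S>\<close>, so that \<open>few\<close> applies to
      them.\<close>
    define S where "S = (\<lambda>(q :: 'm \<Rightarrow> 'a set set wo, W). inv_into (\<Union>\<H>) u ` q ` W)"
    define \<S> where "\<S> = {s \<in> S ` (P \<times> Pow (D (Suc m))). |D 0| \<le>o |s|}"
    show "|heavy \<F> (D (Suc m)) \<H>| \<le>o |\<G>|"
    proof (rule card_of_heavy_ordLeq[OF infG])
      have "|\<S>| \<le>o |S ` (P \<times> Pow (D (Suc m)))|"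
        by (rule card_of_mono1) (auto simp: \<S>_def)
      also have "|S ` (P \<times> Pow (D (Suc m)))| \<le>o |P \<times> Pow (D (Suc m))|"
        by (rule card_of_image)
      also have "|P \<times> Pow (D (Suc m))| \<le>o |\<G>|"
        using ordLeq_ordIso_trans[OF P(1) t]
          ordLeq_transitive[OF ordLeq_transitive[OF Pow_D D_ordLeq_M] M_G]
        by (intro card_of_Times_ordLeq[OF infG])
      finally show "|\<S>| \<le>o |\<G>|" .
      show "|{A \<in> \<F>. s \<subseteq> A}| \<le>o |\<G>|" if "s \<in> \<S>" for s
        using few[of s] that ordLeq_transitive[OF _ G] by (auto simp: \<S>_def)
      show "\<exists>s\<in>\<S>. s \<subseteq> A" if "A \<in> \<F>" and heavy: "|D (Suc m)| \<le>o |A \<inter> \<Union>\<H>|" for A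
      proof -
        obtain f where f: "inj_on f (D (Suc m))" "f ` D (Suc m) \<subseteq> A \<inter> \<Union>\<H>"
          using heavy unfolding card_of_ordLeq[symmetric] by auto
        have "\<forall>x\<in>D (Suc m). u (f x) < t"
          using f(2) u(2) by blast
        then obtain Q where Q: "Q \<subseteq> P" "|Q| \<le>o |D m|" "\<forall>x\<in>D (Suc m). \<exists>q\<in>Q. q x = u (f x)"
          using P(2)[THEN spec[of _ "Suc m"], THEN spec[of _ "\<lambda>x. u (f x)"]] by auto
        define W where "W q = {x \<in> D (Suc m). q x = u (f x)}" for q
        have "\<exists>q\<in>Q. |D 0| \<le>o |W q|"
        proof (rule ccontr)
          assume "\<not> ?thesis"
          hence "|W q| \<le>o |D 0|" if "q \<in> Q" for q
            using that ordLeq_total[OF card_of_Well_order card_of_Well_order] by blast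
          hence "|\<Union>q\<in>Q. W q| \<le>o |D m|"
            using ordLeq_transitive[OF _ D_mono[of 0 m]]
            by (intro card_of_UNION_ordLeq_infinite[OF infinite_D Q(2)]) auto
          moreover have "(\<Union>q\<in>Q. W q) = D (Suc m)"
            using Q(3) by (auto simp: W_def)
          ultimately show False
            using D_ordLess_Suc[of m] not_ordLess_ordLeq by auto
        qed
        then obtain q where q: "q \<in> Q" "|D 0| \<le>o |W q|"
          by auto
        have "inv_into (\<Union>\<H>) u (q x) = f x" if "x \<in> W q" for x
        proof -
          have "f x \<in> \<Union>\<H>" "q x = u (f x)"
            using that f(2) by (auto simp: W_def)
          thus ?thesis
            using inv_into_f_f[OF u(1)] by simp
        qed
        hence S_eq: "S (q, W q) = f ` W q"
          by (auto simp: S_def image_image)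
        have "W q \<subseteq> D (Suc m)"
          by (auto simp: W_def)
        hence "bij_betw f (W q) (S (q, W q))"
          unfolding S_eq using inj_on_subset[OF f(1)] by (simp add: bij_betw_def)
        hence "|D 0| \<le>o |S (q, W q)|"
          using ordLeq_ordIso_trans[OF q(2) card_of_ordIsoI] by blast
        hence "S (q, W q) \<in> \<S>"
          using q(1) Q(1) \<open>W q \<subseteq> D (Suc m)\<close> by (auto simp: \<S>_def)
        moreover have "S (q, W q) \<subseteq> A"
          unfolding S_eq using f(2) \<open>W q \<subseteq> D (Suc m)\<close> by auto
        ultimately show ?thesis
          by blast
      qed
    qed
  qed
qed

lemma card_of_lists_length:
  assumes "infinite C" "|X| \<le>o |C|"
  shows "|{xs. set xs \<subseteq> X \<and> length xs = k}| \<le>o |C|"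
proof (induction k)
  case 0
  have "{xs. set xs \<subseteq> X \<and> length xs = 0} = {[]}"
    by auto
  thus ?case
    using card_of_singl_ordLeq[of C "[]"] assms(1) by auto
next
  case (Suc k)
  have "{xs. set xs \<subseteq> X \<and> length xs = Suc k} = case_prod Cons ` (X \<times> {xs. set xs \<subseteq> X \<and> length xs = k})"
    by (auto simp: length_Suc_conv image_def)
  hence "|{xs. set xs \<subseteq> X \<and> length xs = Suc k}| \<le>o |X \<times> {xs. set xs \<subseteq> X \<and> length xs = k}|"
    by (simp add: card_of_image)
  also have "|X \<times> {xs. set xs \<subseteq> X \<and> length xs = k}| \<le>o |C|"
    by (rule card_of_Times_ordLeq[OF assms Suc])
  finally show ?case .
qed

text \<open>Every heavy set contains \<open>k\<close> points of \<open>\<Union>\<H>\<close>, and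
  lists of length \<open>k\<close> show that there are at most \<open>|\<G>|\<close> such
  \<open>k\<close>-element sets. The bound holds for all \<open>m\<close>, so any threshold
  serves.\<close>

lemma few_heavy_finite:
  fixes \<F> \<G> :: "'a set set" and K :: "'r set"
  assumes inf: "infinite K" and uniform: "\<And>A. A \<in> \<F> \<Longrightarrow> |A| \<le>o |K|"
    and few: "\<And>S. finite S \<Longrightarrow> card S = k \<Longrightarrow> |{A \<in> \<F>. S \<subseteq> A}| \<le>o |K|"
    and G: "|K| \<le>o |\<G>|" and H: "\<H> \<subseteq> \<F>" "|\<H>| \<le>o |\<G>|"
  shows "|heavy \<F> {..<k + m} \<H>| \<le>o |\<G>|"
proof -
  have infG: "infinite \<G>"
    using inf G card_of_ordLeq_finite by blast
  have H_G: "|\<Union>\<H>| \<le>o |\<G>|"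
    using H uniform ordLeq_transitive[OF _ G] by (intro card_of_Union_ordLeq[OF infG]) auto
  define \<S> where "\<S> = {S \<in> set ` {xs. set xs \<subseteq> \<Union>\<H> \<and> length xs = k}. finite S \<and> card S = k}"
  show ?thesis
  proof (rule card_of_heavy_ordLeq[OF infG])
    have "|\<S>| \<le>o |set ` {xs. set xs \<subseteq> \<Union>\<H> \<and> length xs = k}|"
      by (rule card_of_mono1) (auto simp: \<S>_def)
    also have "|set ` {xs. set xs \<subseteq> \<Union>\<H> \<and> length xs = k}| \<le>o |{xs. set xs \<subseteq> \<Union>\<H> \<and> length xs = k}|"
      by (rule card_of_image)
    also have "|{xs. set xs \<subseteq> \<Union>\<H> \<and> length xs = k}| \<le>o |\<G>|"
      by (rule card_of_lists_length[OF infG H_G])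
    finally show "|\<S>| \<le>o |\<G>|" .
    show "|{A \<in> \<F>. s \<subseteq> A}| \<le>o |\<G>|" if "s \<in> \<S>" for s
      using few[of s] that ordLeq_transitive[OF _ G] by (auto simp: \<S>_def)
    show "\<exists>S\<in>\<S>. S \<subseteq> A" if "A \<in> \<F>" and heavy: "|{..<k + m}| \<le>o |A \<inter> \<Union>\<H>|" for A
    proof -
      obtain f where f: "inj_on f {..<k + m}" "f ` {..<k + m} \<subseteq> A \<inter> \<Union>\<H>"
        using heavy unfolding card_of_ordLeq[symmetric] by auto
      have "inj_on f {..<k}"
        using f(1) by (rule inj_on_subset) auto
      hence "card (f ` {..<k}) = k"
        by (simp add: card_image)
      moreover have "f ` {..<k} = set (map f [0..<k])"
        by auto
      moreover have "f ` {..<k} \<subseteq> \<Union>\<H>"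
        using f(2) by auto
      ultimately have "f ` {..<k} \<in> \<S>"
        unfolding \<S>_def by (intro CollectI conjI image_eqI[of _ _ "map f [0..<k]"]) simp_all
      moreover have "f ` {..<k} \<subseteq> A"
        using f(2) by auto
      ultimately show ?thesis
        by blast
    qed
  qed
qed

text \<open>More than \<open>\<rho>\<close> members containing \<open>S\<close> would include
  \<open>\<rho>\<^sup>+\<close> many, whose intersection contains \<open>S\<close> and so has at
  least \<open>\<nu>\<close> points.\<close>

lemma card_of_supersets_ordLeq:
  assumes \<rho>: "Card_order \<rho>" and C: "cond_C (cardSuc \<rho>) \<nu> \<F>" and S: "\<nu> \<le>o |S|"
  shows "|{A \<in> \<F>. S \<subseteq> A}| \<le>o |Field \<rho>|"
proof (rule ccontr)
  let ?X = "{A \<in> \<F>. S \<subseteq> A}"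
  assume "\<not> ?thesis"
  hence "|Field \<rho>| <o |?X|"
    by (rule not_ordLeq_iff_ordLess[OF card_of_Well_order card_of_Well_order, THEN iffD1])
  hence "\<rho> <o |?X|"
    using ordIso_ordLess_trans[OF ordIso_symmetric[OF card_of_Field_ordIso[OF \<rho>]]] by blast
  hence "cardSuc \<rho> \<le>o |?X|"
    using cardSuc_ordLess_ordLeq[OF \<rho> card_of_Card_order] by blast
  moreover have suc: "|Field (cardSuc \<rho>)| =o cardSuc \<rho>"
    by (rule card_of_Field_ordIso[OF cardSuc_Card_order[OF \<rho>]])
  ultimately have "|Field (cardSuc \<rho>)| \<le>o |?X|"
    using ordIso_ordLeq_trans by blast
  then obtain \<A> where \<A>: "\<A> \<subseteq> ?X" "|Field (cardSuc \<rho>)| =o |\<A>|"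
    unfolding internalize_card_of_ordLeq2[of "Field (cardSuc \<rho>)" ?X] by auto
  have "|\<A>| =o cardSuc \<rho>"
    using ordIso_transitive[OF ordIso_symmetric[OF \<A>(2)] suc] .
  hence "|\<Inter>\<A>| <o \<nu>"
    using C \<A>(1) unfolding cond_C_def by blast
  moreover have "|S| \<le>o |\<Inter>\<A>|"
    using \<A>(1) by (intro card_of_mono1) auto
  ultimately show False
    using S ordLeq_transitive not_ordLess_ordLeq by blast
qed

text \<open>\<open>R\<close> has order type \<open>|\<F>|\<close>: it is not shorter, as the
  cardinal is the least well-order of \<open>\<F>\<close>, and not longer, as its proper initial
  segments are smaller than \<open>\<F>\<close>. The isomorphism serves as the enumeration.\<close>

lemma (in tame_family) ex_enumeration:
  assumes \<rho>: "Card_order \<rho>" and K: "K = Field \<rho>"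
  shows "\<exists>(A :: 'a set \<Rightarrow> 'a set) (d :: 'a set \<Rightarrow> 'a set).
    bij_betw A (Field |\<F>| ) \<F> \<and>
    (\<forall>\<alpha>\<in>Field |\<F>|. d \<alpha> \<in> subsets_of_card (A \<alpha>) \<rho>) \<and>
    (\<forall>\<alpha>\<in>Field |\<F>|. \<forall>\<beta>\<in>underS |\<F>| \<alpha>. d \<beta> \<inter> d \<alpha> = {}) \<and>
    (\<forall>\<alpha>\<in>Field |\<F>|. |{\<beta> \<in> underS |\<F>| \<alpha>. A \<beta> \<inter> d \<alpha> \<noteq> {}}| <o \<rho>)"
proof -
  obtain R d where "splitting K \<F> R d"
    using ex_splitting[OF subset_refl] by auto
  hence R: "Well_order R" "Field R = \<F>" "\<And>A. A \<in> \<F> \<Longrightarrow> |underS R A| <o |\<F>|"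
    and d: "\<And>A. A \<in> \<F> \<Longrightarrow> d A \<subseteq> A" "\<And>A. A \<in> \<F> \<Longrightarrow> |d A| =o |K|"
      "\<And>A B. A \<in> \<F> \<Longrightarrow> B \<in> underS R A \<Longrightarrow> d B \<inter> d A = {}"
      "\<And>A. A \<in> \<F> \<Longrightarrow> |{B \<in> underS R A. B \<inter> d A \<noteq> {}}| <o |K|"
    by (auto simp: splitting_def)
  define r where "r = |\<F>|"
  have r: "Well_order r" "Field r = \<F>"
    by (simp_all add: r_def card_of_well_order_on Field_card_of)
  have K_\<rho>: "|K| =o \<rho>"
    unfolding K by (rule card_of_Field_ordIso[OF \<rho>])
  have "r \<le>o R"
    unfolding r_def using R(1,2) by (intro card_of_least) simp
  moreover have "\<not> r <o R"
  proof
    assume "r <o R"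
    then obtain b where "b \<in> Field R" "|\<F>| =o |underS R b|"
      using ex_underS_ordIso[OF _ R(1), of \<F>] by (auto simp: r_def)
    thus False
      using R(2,3) ordIso_symmetric not_ordLess_ordIso by blast
  qed
  ultimately have "r =o R"
    using ordLeq_iff_ordLess_or_ordIso by blast
  then obtain A where A: "iso r R A"
    by (auto simp: ordIso_def)
  hence bij: "bij_betw A (Field r) (Field R)" and emb: "embed r R A"
    by (simp_all add: iso_def)
  have A_F: "A \<alpha> \<in> \<F>" if "\<alpha> \<in> Field r" for \<alpha>
    using bij that R(2) by (auto simp: bij_betw_def)
  have under: "bij_betw A (underS r \<alpha>) (underS R (A \<alpha>))" if "\<alpha> \<in> Field r" for \<alpha>
    by (rule embed_underS[OF r(1) emb that])
  have A_under: "A \<beta> \<in> underS R (A \<alpha>)" if "\<alpha> \<in> Field r" "\<beta> \<in> underS r \<alpha>" for \<alpha> \<beta>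
    using under[OF that(1)] that(2) by (auto simp: bij_betw_def)
  have "d (A \<alpha>) \<in> subsets_of_card (A \<alpha>) \<rho>" if "\<alpha> \<in> Field r" for \<alpha>
    using d(1,2)[OF A_F[OF that]] K_\<rho> ordIso_transitive by (auto simp: subsets_of_card_def)
  moreover have "d (A \<beta>) \<inter> d (A \<alpha>) = {}" if "\<alpha> \<in> Field r" "\<beta> \<in> underS r \<alpha>" for \<alpha> \<beta>
    by (rule d(3)[OF A_F[OF that(1)] A_under[OF that]])
  moreover have "|{\<beta> \<in> underS r \<alpha>. A \<beta> \<inter> d (A \<alpha>) \<noteq> {}}| <o \<rho>" if \<alpha>: "\<alpha> \<in> Field r" for \<alpha>
  proof -
    have "|{\<beta> \<in> underS r \<alpha>. A \<beta> \<inter> d (A \<alpha>) \<noteq> {}}| \<le>o |{B \<in> underS R (A \<alpha>). B \<inter> d (A \<alpha>) \<noteq> {}}|"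
    proof (rule card_of_ordLeqI)
      show "inj_on A {\<beta> \<in> underS r \<alpha>. A \<beta> \<inter> d (A \<alpha>) \<noteq> {}}"
        using under[OF \<alpha>] by (auto simp: bij_betw_def inj_on_def)
      show "A \<beta> \<in> {B \<in> underS R (A \<alpha>). B \<inter> d (A \<alpha>) \<noteq> {}}"
        if "\<beta> \<in> {\<beta> \<in> underS r \<alpha>. A \<beta> \<inter> d (A \<alpha>) \<noteq> {}}" for \<beta>
        using that A_under[OF \<alpha>, of \<beta>] by simp
    qed
    also note d(4)[OF A_F[OF \<alpha>]]
    also note K_\<rho>
    finally show ?thesis .
  qed
  ultimately show ?thesis
    unfolding r_def[symmetric] using bij R(2)
    by (intro exI[of _ A] exI[of _ "\<lambda>\<alpha>. d (A \<alpha>)"]) simp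
qed

theorem theorem4p7:
  fixes \<nu> :: "'n rel" and \<mu> :: "'m rel" and \<rho> :: "'r rel" and \<F> :: "'a set set"
  assumes "Card_order \<nu>" and "Card_order \<rho>"
    and "is_beth_omega \<nu> \<mu>" and "\<mu> \<le>o \<rho>"
    and "uniform_family \<rho> \<F>"
    and "cond_C (cardSuc \<rho>) \<nu> \<F>"
  shows "\<exists>(A :: 'a set \<Rightarrow> 'a set) (d :: 'a set \<Rightarrow> 'a set).
    bij_betw A (Field |\<F>| ) \<F> \<and>
    (\<forall>\<alpha>\<in>Field |\<F>|. d \<alpha> \<in> subsets_of_card (A \<alpha>) \<rho>) \<and>
    (\<forall>\<alpha>\<in>Field |\<F>|. \<forall>\<beta>\<in>underS |\<F>| \<alpha>. d \<beta> \<inter> d \<alpha> = {}) \<and>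
    (\<forall>\<alpha>\<in>Field |\<F>|. |{\<beta> \<in> underS |\<F>| \<alpha>. A \<beta> \<inter> d \<alpha> \<noteq> {}}| <o \<rho>)"
proof -
  obtain b :: "nat \<Rightarrow> 'm rel" where b: "\<And>n. Card_order (b n)" "b 0 =o \<nu>"
    "\<And>n. b (Suc n) =o ctwo ^c b n" "\<And>n. b n \<le>o \<mu>"
    using assms(3) unfolding is_beth_omega_def is_beth_seq_def by blast
  let ?K = "Field \<rho>"
  define D where "D n = Field (b n)" for n
  have D: "|D n| =o b n" for n
    unfolding D_def by (rule card_of_Field_ordIso[OF b(1)])
  have K: "|?K| =o \<rho>"
    by (rule card_of_Field_ordIso[OF assms(2)])
  have Pow_D: "|Pow (D n)| =o |D (Suc n)|" for n
  proof -
    have "|Pow (D n)| =o ctwo ^c b n"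
      using card_of_Pow_Func[of "D n"] by (simp add: cexp_def ctwo_def Field_card_of D_def)
    also have "ctwo ^c b n =o b (Suc n)"
      by (rule ordIso_symmetric[OF b(3)])
    also have "b (Suc n) =o |D (Suc n)|"
      by (rule ordIso_symmetric[OF D])
    finally show ?thesis .
  qed
  have D_K: "|D n| \<le>o |?K|" for n
  proof -
    note D
    also note b(4)
    also note assms(4)
    also note ordIso_symmetric[OF K]
    finally show ?thesis .
  qed
  \<comment> \<open>For finite \<open>\<rho>\<close> all \<open>D n\<close> would be finite with
    \<open>n \<le> card (D n)\<close>, against the common bound \<open>card ?K\<close>.\<close>
  have inf_K: "infinite ?K"
  proof
    assume fin: "finite ?K"
    have D_fin: "finite (D n)" for n
      using D_K fin card_of_ordLeq_finite by blast
    have "n \<le> card (D n)" for n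
    proof (induction n)
      case (Suc n)
      have "card (Pow (D n)) = card (D (Suc n))"
        using Pow_D[of n] card_of_ordIso[symmetric] bij_betw_same_card by blast
      hence "card (D (Suc n)) = 2 ^ card (D n)"
        by (simp add: card_Pow D_fin)
      thus ?case
        using Suc less_exp[of "card (D n)"] by linarith
    qed simp
    moreover have "card (D n) \<le> card ?K" for n
    proof -
      obtain f where "inj_on f (D n)" "f ` D n \<subseteq> ?K"
        using D_K[of n] unfolding card_of_ordLeq[symmetric] by auto
      thus ?thesis
        by (rule card_inj_on_le[OF _ _ fin])
    qed
    ultimately show False
      using le_trans not_less_eq_eq by blast
  qed
  have unif: "|A| =o |?K|" if "A \<in> \<F>" for A
    using assms(5) that ordIso_transitive[OF _ ordIso_symmetric[OF K]]
    by (auto simp: uniform_family_def)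
  have unif': "|A| \<le>o |?K|" if "A \<in> \<F>" for A
    using unif[OF that] by (rule ordIso_imp_ordLeq)
  have few: "|{A \<in> \<F>. S \<subseteq> A}| \<le>o |?K|" if "|D 0| \<le>o |S|" for S
  proof (rule card_of_supersets_ordLeq[OF assms(2) assms(6)])
    show "\<nu> \<le>o |S|"
      using ordIso_ordLeq_trans[OF ordIso_symmetric[OF ordIso_transitive[OF D b(2)]] that] .
  qed
  show ?thesis
  proof (cases "finite (D 0)")
    case True
    define k where "k = card (D 0)"
    have few_k: "|{A \<in> \<F>. S \<subseteq> A}| \<le>o |?K|" if S: "finite S" "card S = k" for S
    proof (rule few)
      obtain f where "bij_betw f (D 0) S"
        using finite_same_card_bij[OF True S(1)] S(2) by (auto simp: k_def)
      thus "|D 0| \<le>o |S|"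
        by (intro ordIso_imp_ordLeq card_of_ordIsoI)
    qed
    interpret tame_family \<F> ?K "\<lambda>n. {..<k + n}"
    proof
      show "|{..<k + n}| <o |{..<k + Suc n}|" for n
      proof (rule not_ordLeq_iff_ordLess[OF card_of_Well_order card_of_Well_order, THEN iffD1], rule notI)
        assume "|{..<k + Suc n}| \<le>o |{..<k + n}|"
        then obtain f where "inj_on f {..<k + Suc n}" "f ` {..<k + Suc n} \<subseteq> {..<k + n}"
          unfolding card_of_ordLeq[symmetric] by auto
        hence "card {..<k + Suc n} \<le> card {..<k + n}"
          by (rule card_inj_on_le) simp
        thus False
          by simp
      qed
      show "|{..<k + n}| \<le>o |?K|" for n
        by (rule ordLeq_transitive[OF card_of_mono1[of _ UNIV] card_of_nat_ordLeq[OF inf_K]]) simp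
      show "\<exists>n. \<forall>m\<ge>n. \<forall>\<H>\<subseteq>\<F>. |\<H>| \<le>o |\<G>| \<longrightarrow> |heavy \<F> {..<k + m} \<H>| \<le>o |\<G>|"
        if "|?K| \<le>o |\<G>|" for \<G> :: "'a set set"
        using few_heavy_finite[OF inf_K unif' few_k that] by auto
    qed (use inf_K unif in auto)
    show ?thesis
      by (rule ex_enumeration[OF assms(2) refl])
  next
    case False
    interpret beth_tower D
      using False Pow_D ordIso_imp_ordLeq by unfold_locales auto
    have M_K: "|M| \<le>o |?K|"
      using D_K by (intro card_of_UNION_ordLeq_infinite[OF inf_K] card_of_nat_ordLeq[OF inf_K]) auto
    \<comment> \<open>The shift to \<open>D (Suc n)\<close> leaves room for the pigeonhole step that
      compares \<open>D n\<close> with \<open>D (Suc n)\<close>.\<close>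
    interpret tame_family \<F> ?K "\<lambda>n. D (Suc n)"
    proof
      show "\<exists>n. \<forall>m\<ge>n. \<forall>\<H>\<subseteq>\<F>. |\<H>| \<le>o |\<G>| \<longrightarrow> |heavy \<F> (D (Suc m)) \<H>| \<le>o |\<G>|"
        if "|?K| \<le>o |\<G>|" for \<G> :: "'a set set"
        by (rule few_heavy_infinite[OF inf_K M_K unif' few that])
    qed (use inf_K unif D_ordLess_Suc D_K in auto)
    show ?thesis
      by (rule ex_enumeration[OF assms(2) refl])
  qed
qed

end
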